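(* $\mathsf{RCA}_0 + \mathsf{DNR} \nvdash \mathsf{RWKL}$. That is, $\mathsf{RWKL}$ is not provable in $\mathsf{RCA}_0 + \mathsf{DNR}$.
   Context: $\mathsf{RCA}_0$ is the subsystem of second-order arithmetic axiomatized by the basic axioms of arithmetic, $\Sigma^0_1$ induction and $\Delta^0_1$ comprehension. $\mathbb{N}$ denotes the first-order part of a possibly nonstandard model. $(\Phi_e^X)_{e \in \mathbb{N}}$ is the standard list of partial functions recursive in $X$. $\mathsf{DNR}$ is the statement "for every set $X$ there is a function $f \colon \mathbb{N} \to \mathbb{N}$ such that $\forall e\,(f(e) \neq \Phi_e^X(e))$" (where $f(e) \neq \Phi_e^X(e)$ holds in particular if $\Phi_e^X(e)$ is undefined). A tree is a set of finite strings closed under initial segments. A set $H \subseteq \mathbb{N}$ is homogeneous for a string $\sigma \in 2^{<\mathbb{N}}$ if $(\exists c < 2)(\forall i \in H)(i < |\sigma| \rightarrow \sigma(i) = c)$. A set $H \subseteq \mathbb{N}$ is homogeneous for an infinite tree $T \subseteq 2^{<\mathbb{N}}$ if the tree $\{\sigma \in T : H \text{ is homogeneous for } \sigma\}$ is infinite. $\mathsf{RWKL}$ (Ramsey-type weak König's lemma) is the statement "for every infinite tree $T \subseteq 2^{<\mathbb{N}}$, there is an infinite set $H \subseteq \mathbb{N}$ that is homogeneous for $T$." *)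

theory Defs
  imports Main
begin

section \<open>The two-sorted language of second-order arithmetic\<close>

text \<open>
  Variables of both sorts are de Bruijn indices, and the two sorts are indexed independently: a
  number quantifier binds the number variable 0 of its body and leaves the set indices alone, and
  vice versa.
\<close>

datatype tm =
    Var nat
  | Zero  ("\<^bold>0")
  | One  ("\<^bold>1")
  | Add tm tm  (infixl "\<^bold>+" 65)
  | Mult tm tm  (infixl "\<^bold>*" 70)

datatype fm =
    Fls  ("\<^bold>\<bottom>")
  | Eq tm tm  (infix "\<^bold>=" 50)
  | Less tm tm  (infix "\<^bold><" 50)
  | Mem tm nat  (infix "\<^bold>\<in>" 50)
  | Imp fm fm  (infixr "\<^bold>\<longrightarrow>" 25)
  | All fm  ("\<^bold>\<forall>_" [40] 40)
  | SAll fm  ("\<^bold>\<forall>\<^sub>2_" [40] 40)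

definition Neg :: "fm \<Rightarrow> fm"  ("\<^bold>\<not>_" [40] 40) where
  "Neg p = (p \<^bold>\<longrightarrow> \<^bold>\<bottom>)"

definition Dis :: "fm \<Rightarrow> fm \<Rightarrow> fm"  (infixr "\<^bold>\<or>" 30) where
  "Dis p q = (\<^bold>\<not>p \<^bold>\<longrightarrow> q)"

definition Con :: "fm \<Rightarrow> fm \<Rightarrow> fm"  (infixr "\<^bold>\<and>" 35) where
  "Con p q = Neg (p \<^bold>\<longrightarrow> \<^bold>\<not>q)"

definition Iff :: "fm \<Rightarrow> fm \<Rightarrow> fm"  (infixr "\<^bold>\<longleftrightarrow>" 25) where
  "Iff p q = ((p \<^bold>\<longrightarrow> q) \<^bold>\<and> (q \<^bold>\<longrightarrow> p))"

definition Ex :: "fm \<Rightarrow> fm"  ("\<^bold>\<exists>_" [40] 40) where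
  "Ex p = (\<^bold>\<not>\<^bold>\<forall>\<^bold>\<not>p)"

definition SEx :: "fm \<Rightarrow> fm"  ("\<^bold>\<exists>\<^sub>2_" [40] 40) where
  "SEx p = (\<^bold>\<not>\<^bold>\<forall>\<^sub>2\<^bold>\<not>p)"

text \<open>
  Simultaneous substitution: \<open>\<sigma>\<close> replaces number variables by terms, \<open>\<rho>\<close> renames set variables
  (there are no other set terms).
\<close>

primrec tsubst :: "(nat \<Rightarrow> tm) \<Rightarrow> tm \<Rightarrow> tm" where
  "tsubst \<sigma> (Var i) = \<sigma> i"
| "tsubst \<sigma> \<^bold>0 = \<^bold>0"
| "tsubst \<sigma> \<^bold>1 = \<^bold>1"
| "tsubst \<sigma> (s \<^bold>+ t) = tsubst \<sigma> s \<^bold>+ tsubst \<sigma> t"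
| "tsubst \<sigma> (s \<^bold>* t) = tsubst \<sigma> s \<^bold>* tsubst \<sigma> t"

definition lift :: "tm \<Rightarrow> nat \<Rightarrow> tm"  (infixl "\<up>" 80) where
  "t \<up> n = tsubst (\<lambda>i. Var (i + n)) t"

primrec subst :: "(nat \<Rightarrow> tm) \<Rightarrow> (nat \<Rightarrow> nat) \<Rightarrow> fm \<Rightarrow> fm" where
  "subst \<sigma> \<rho> \<^bold>\<bottom> = \<^bold>\<bottom>"
| "subst \<sigma> \<rho> (s \<^bold>= t) = (tsubst \<sigma> s \<^bold>= tsubst \<sigma> t)"
| "subst \<sigma> \<rho> (s \<^bold>< t) = (tsubst \<sigma> s \<^bold>< tsubst \<sigma> t)"
| "subst \<sigma> \<rho> (t \<^bold>\<in> X) = (tsubst \<sigma> t \<^bold>\<in> \<rho> X)"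
| "subst \<sigma> \<rho> (p \<^bold>\<longrightarrow> q) = (subst \<sigma> \<rho> p \<^bold>\<longrightarrow> subst \<sigma> \<rho> q)"
| "subst \<sigma> \<rho> (\<^bold>\<forall>p) = (\<^bold>\<forall>(subst (case_nat (Var 0) (\<lambda>i. \<sigma> i \<up> 1)) \<rho> p))"
| "subst \<sigma> \<rho> (\<^bold>\<forall>\<^sub>2p) = (\<^bold>\<forall>\<^sub>2(subst \<sigma> (case_nat 0 (\<lambda>i. Suc (\<rho> i))) p))"

abbreviation inst :: "tm \<Rightarrow> fm \<Rightarrow> fm" where
  "inst t \<equiv> subst (case_nat t Var) id"

abbreviation sinst :: "nat \<Rightarrow> fm \<Rightarrow> fm" where
  "sinst X \<equiv> subst Var (case_nat X id)"

abbreviation flift :: "fm \<Rightarrow> fm" where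
  "flift \<equiv> subst (\<lambda>i. Var (Suc i)) id"

abbreviation slift :: "fm \<Rightarrow> fm" where
  "slift \<equiv> subst Var Suc"

primrec tclosed :: "nat \<Rightarrow> tm \<Rightarrow> bool" where
  "tclosed n (Var i) \<longleftrightarrow> i < n"
| "tclosed n \<^bold>0 \<longleftrightarrow> True"
| "tclosed n \<^bold>1 \<longleftrightarrow> True"
| "tclosed n (s \<^bold>+ t) \<longleftrightarrow> tclosed n s \<and> tclosed n t"
| "tclosed n (s \<^bold>* t) \<longleftrightarrow> tclosed n s \<and> tclosed n t"

primrec closed :: "nat \<Rightarrow> nat \<Rightarrow> fm \<Rightarrow> bool" where
  "closed n m \<^bold>\<bottom> \<longleftrightarrow> True"
| "closed n m (s \<^bold>= t) \<longleftrightarrow> tclosed n s \<and> tclosed n t"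
| "closed n m (s \<^bold>< t) \<longleftrightarrow> tclosed n s \<and> tclosed n t"
| "closed n m (t \<^bold>\<in> X) \<longleftrightarrow> tclosed n t \<and> X < m"
| "closed n m (p \<^bold>\<longrightarrow> q) \<longleftrightarrow> closed n m p \<and> closed n m q"
| "closed n m (\<^bold>\<forall>p) \<longleftrightarrow> closed (Suc n) m p"
| "closed n m (\<^bold>\<forall>\<^sub>2p) \<longleftrightarrow> closed n (Suc m) p"

definition universal_closures :: "fm \<Rightarrow> fm set" where
  "universal_closures p = {(SAll ^^ m) ((All ^^ n) p) | n m. closed n m p}"


section \<open>Provability\<close>

text \<open>
  Classical two-sorted natural deduction with equality on numbers. Lifting the whole context in the
  two introduction rules for the quantifiers is the eigenvariable condition.
\<close>

inductive provable :: "fm set \<Rightarrow> fm \<Rightarrow> bool"  (infix "\<turnstile>" 20) where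
  Hyp: "p \<in> \<Gamma> \<Longrightarrow> \<Gamma> \<turnstile> p"
| ImpI: "insert p \<Gamma> \<turnstile> q \<Longrightarrow> \<Gamma> \<turnstile> (p \<^bold>\<longrightarrow> q)"
| ImpE: "\<Gamma> \<turnstile> (p \<^bold>\<longrightarrow> q) \<Longrightarrow> \<Gamma> \<turnstile> p \<Longrightarrow> \<Gamma> \<turnstile> q"
| Contr: "insert (\<^bold>\<not>p) \<Gamma> \<turnstile> \<^bold>\<bottom> \<Longrightarrow> \<Gamma> \<turnstile> p"
| AllI: "flift ` \<Gamma> \<turnstile> p \<Longrightarrow> \<Gamma> \<turnstile> \<^bold>\<forall>p"
| AllE: "\<Gamma> \<turnstile> \<^bold>\<forall>p \<Longrightarrow> \<Gamma> \<turnstile> inst t p"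
| SAllI: "slift ` \<Gamma> \<turnstile> p \<Longrightarrow> \<Gamma> \<turnstile> \<^bold>\<forall>\<^sub>2p"
| SAllE: "\<Gamma> \<turnstile> \<^bold>\<forall>\<^sub>2p \<Longrightarrow> \<Gamma> \<turnstile> sinst X p"
| EqRefl: "\<Gamma> \<turnstile> (t \<^bold>= t)"
| EqSubst: "\<Gamma> \<turnstile> (s \<^bold>= t) \<Longrightarrow> \<Gamma> \<turnstile> inst s p \<Longrightarrow> \<Gamma> \<turnstile> inst t p"


section \<open>The axioms of \<open>RCA\<^sub>0\<close>\<close>

text \<open>The bounded existential quantifier is the negation of a bounded universal one.\<close>

inductive Delta0 :: "fm \<Rightarrow> bool" where
  "Delta0 \<^bold>\<bottom>"
| "Delta0 (s \<^bold>= t)"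
| "Delta0 (s \<^bold>< t)"
| "Delta0 (t \<^bold>\<in> X)"
| "Delta0 p \<Longrightarrow> Delta0 q \<Longrightarrow> Delta0 (p \<^bold>\<longrightarrow> q)"
| "Delta0 p \<Longrightarrow> Delta0 (\<^bold>\<forall>(Var 0 \<^bold>< t \<up> 1 \<^bold>\<longrightarrow> p))"

definition Sigma1 :: "fm \<Rightarrow> bool" where
  "Sigma1 p \<longleftrightarrow> (\<exists>q. Delta0 q \<and> p = (\<^bold>\<exists>q))"

definition Pi1 :: "fm \<Rightarrow> bool" where
  "Pi1 p \<longleftrightarrow> (\<exists>q. Delta0 q \<and> p = (\<^bold>\<forall>q))"

definition basic_axioms :: "fm set" where
  "basic_axioms =
    {\<^bold>\<not>(Var 0 \<^bold>+ \<^bold>1 \<^bold>= \<^bold>0),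
     (Var 0 \<^bold>+ \<^bold>1 \<^bold>= Var 1 \<^bold>+ \<^bold>1) \<^bold>\<longrightarrow> (Var 0 \<^bold>= Var 1),
     Var 0 \<^bold>+ \<^bold>0 \<^bold>= Var 0,
     Var 0 \<^bold>+ (Var 1 \<^bold>+ \<^bold>1) \<^bold>= (Var 0 \<^bold>+ Var 1) \<^bold>+ \<^bold>1,
     Var 0 \<^bold>* \<^bold>0 \<^bold>= \<^bold>0,
     Var 0 \<^bold>* (Var 1 \<^bold>+ \<^bold>1) \<^bold>= (Var 0 \<^bold>* Var 1) \<^bold>+ Var 0,
     \<^bold>\<not>(Var 0 \<^bold>< \<^bold>0),
     (Var 0 \<^bold>< Var 1 \<^bold>+ \<^bold>1) \<^bold>\<longleftrightarrow> (Var 0 \<^bold>< Var 1) \<^bold>\<or> (Var 0 \<^bold>= Var 1)}"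

text \<open>
  In both schemes the number variable 0 of \<open>p\<close> is the induction or comprehension variable, and all
  other variables are parameters.
\<close>

definition induction_axiom :: "fm \<Rightarrow> fm" where
  "induction_axiom p =
    (inst \<^bold>0 p \<^bold>\<and> \<^bold>\<forall>(p \<^bold>\<longrightarrow> subst (case_nat (Var 0 \<^bold>+ \<^bold>1) (\<lambda>i. Var (Suc i))) id p)
      \<^bold>\<longrightarrow> \<^bold>\<forall>p)"

text \<open>The lifting says that the set that is asserted to exist does not occur in \<open>p\<close>.\<close>

definition comprehension_axiom :: "fm \<Rightarrow> fm \<Rightarrow> fm" where
  "comprehension_axiom p q =
    (\<^bold>\<forall>(p \<^bold>\<longleftrightarrow> q) \<^bold>\<longrightarrow> \<^bold>\<exists>\<^sub>2\<^bold>\<forall>(Var 0 \<^bold>\<in> 0 \<^bold>\<longleftrightarrow> slift p))"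

definition RCA0 :: "fm set" where
  "RCA0 = \<Union> (universal_closures `
    (basic_axioms
      \<union> {induction_axiom p | p. Sigma1 p}
      \<union> {comprehension_axiom p q | p q. Sigma1 p \<and> Pi1 q}))"


section \<open>Coding finite sequences\<close>

text \<open>
  Formulas with term arguments are metalevel functions; an argument that is used below \<open>n\<close> number
  quantifiers has to be lifted by \<open>n\<close>. The coding is the one of Simpson's \<^emph>\<open>Subsystems of Second
  Order Arithmetic\<close>, Section II.2: \<open>(i, j) = (i + j)\<^sup>2 + i\<close>, and a finite set is coded by the least
  number of the form \<open>(k, (m, n))\<close> such that \<open>i\<close> is an element iff \<open>i < k\<close> and \<open>m(i + 1) + 1\<close>
  divides \<open>n\<close>.
\<close>

primrec num :: "nat \<Rightarrow> tm" where
  "num 0 = \<^bold>0"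
| "num (Suc n) = num n \<^bold>+ \<^bold>1"

definition Le :: "tm \<Rightarrow> tm \<Rightarrow> fm"  (infix "\<^bold>\<le>" 50) where
  "Le s t = (s \<^bold>< t \<^bold>+ \<^bold>1)"

definition Dvd :: "tm \<Rightarrow> tm \<Rightarrow> fm" where
  "Dvd s t = (\<^bold>\<exists>(t\<up>1 \<^bold>= s\<up>1 \<^bold>* Var 0))"

definition pair :: "tm \<Rightarrow> tm \<Rightarrow> tm" where
  "pair s t = (s \<^bold>+ t) \<^bold>* (s \<^bold>+ t) \<^bold>+ s"

definition triple :: "tm \<Rightarrow> tm \<Rightarrow> tm \<Rightarrow> tm" where
  "triple s t u = pair s (pair t u)"

definition in_code :: "tm \<Rightarrow> tm \<Rightarrow> fm" where
  "in_code i c = (\<^bold>\<exists>\<^bold>\<exists>\<^bold>\<exists>(let k = Var 2; m = Var 1; n = Var 0 in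
    c\<up>3 \<^bold>= triple k m n \<^bold>\<and> i\<up>3 \<^bold>< k \<^bold>\<and> Dvd (m \<^bold>* (i\<up>3 \<^bold>+ \<^bold>1) \<^bold>+ \<^bold>1) n))"

text \<open>
  A number that is not of the form \<open>(k, (m, n))\<close> has no elements in the sense of \<open>in_code\<close>, and
  \<open>0 = (0, (0, 0))\<close> is the code of the empty set.
\<close>

definition fin_code :: "tm \<Rightarrow> fm" where
  "fin_code c = (\<^bold>\<forall>(Var 0 \<^bold>< c\<up>1 \<^bold>\<longrightarrow> \<^bold>\<not>\<^bold>\<forall>(in_code (Var 0) (Var 1) \<^bold>\<longleftrightarrow> in_code (Var 0) (c\<up>2))))"

definition entry :: "tm \<Rightarrow> tm \<Rightarrow> tm \<Rightarrow> fm" where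
  "entry s i x = in_code (pair i x) s"

text \<open>\<open>s\<close> is the code of a finite sequence of length \<open>l\<close>.\<close>

definition seq :: "tm \<Rightarrow> tm \<Rightarrow> fm" where
  "seq s l =
    (fin_code s
     \<^bold>\<and> \<^bold>\<forall>(in_code (Var 0) (s\<up>1) \<^bold>\<longrightarrow> \<^bold>\<exists>\<^bold>\<exists>(let p = Var 2; i = Var 1; x = Var 0 in
          i \<^bold>< l\<up>3 \<^bold>\<and> p \<^bold>= pair i x))
     \<^bold>\<and> \<^bold>\<forall>(Var 0 \<^bold>< l\<up>1 \<^bold>\<longrightarrow> \<^bold>\<exists>(entry (s\<up>2) (Var 1) (Var 0)
          \<^bold>\<and> \<^bold>\<forall>(entry (s\<up>3) (Var 2) (Var 0) \<^bold>\<longrightarrow> Var 0 \<^bold>= Var 1))))"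

text \<open>The set with index \<open>F\<close> is a function from numbers to numbers.\<close>

definition func :: "nat \<Rightarrow> fm" where
  "func F =
    (\<^bold>\<forall>(Var 0 \<^bold>\<in> F \<^bold>\<longrightarrow> \<^bold>\<exists>\<^bold>\<exists>(Var 2 \<^bold>= pair (Var 1) (Var 0)))
     \<^bold>\<and> \<^bold>\<forall>\<^bold>\<exists>(pair (Var 1) (Var 0) \<^bold>\<in> F
          \<^bold>\<and> \<^bold>\<forall>(pair (Var 2) (Var 0) \<^bold>\<in> F \<^bold>\<longrightarrow> Var 0 \<^bold>= Var 1)))"


section \<open>The partial functions recursive in a set\<close>

text \<open>
  Indices follow Kleene's generation of the partial recursive functions, with all functions unary
  and several arguments paired:

    \<^item> \<open>(0, 0)\<close>: \<open>x \<mapsto> 0\<close>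
    \<^item> \<open>(1, 0)\<close>: \<open>x \<mapsto> x + 1\<close>
    \<^item> \<open>(2, 0)\<close>: \<open>x \<mapsto> x\<close>
    \<^item> \<open>(3, 0)\<close>, \<open>(4, 0)\<close>: the projections \<open>(u, v) \<mapsto> u\<close> and \<open>(u, v) \<mapsto> v\<close>
    \<^item> \<open>(5, 0)\<close>: the characteristic function of the oracle
    \<^item> \<open>(6, (a, b))\<close>: \<open>x \<mapsto> (\<Phi>\<^sub>a(x), \<Phi>\<^sub>b(x))\<close>
    \<^item> \<open>(7, (a, b))\<close>: \<open>x \<mapsto> \<Phi>\<^sub>a(\<Phi>\<^sub>b(x))\<close>
    \<^item> \<open>(8, (a, b))\<close>: primitive recursion, \<open>(u, 0) \<mapsto> \<Phi>\<^sub>a(u)\<close> and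
      \<open>(u, k + 1) \<mapsto> \<Phi>\<^sub>b(u, (k, v))\<close>, where \<open>v\<close> is the value at \<open>(u, k)\<close>
    \<^item> \<open>(9, a)\<close>: minimization, \<open>x \<mapsto> (\<mu>y. \<Phi>\<^sub>a(x, y) = 0)\<close>

  A computation is a finite sequence of triples \<open>(e, (x, y))\<close>, read as \<open>\<Phi>\<^sub>e(x) = y\<close>, each of which
  follows from earlier ones by one of these clauses. All other numbers are indices of the nowhere
  defined function.
\<close>

definition earlier :: "tm \<Rightarrow> tm \<Rightarrow> tm \<Rightarrow> tm \<Rightarrow> tm \<Rightarrow> fm" where
  "earlier s j e x y = (\<^bold>\<exists>(Var 0 \<^bold>< j\<up>1 \<^bold>\<and> entry (s\<up>1) (Var 0) (triple (e\<up>1) (x\<up>1) (y\<up>1))))"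

definition justified :: "nat \<Rightarrow> tm \<Rightarrow> tm \<Rightarrow> tm \<Rightarrow> tm \<Rightarrow> tm \<Rightarrow> fm" where
  "justified X s j e x y =
    ((e \<^bold>= pair (num 0) \<^bold>0 \<^bold>\<and> y \<^bold>= \<^bold>0)
     \<^bold>\<or> (e \<^bold>= pair (num 1) \<^bold>0 \<^bold>\<and> y \<^bold>= x \<^bold>+ \<^bold>1)
     \<^bold>\<or> (e \<^bold>= pair (num 2) \<^bold>0 \<^bold>\<and> y \<^bold>= x)
     \<^bold>\<or> (e \<^bold>= pair (num 3) \<^bold>0 \<^bold>\<and> \<^bold>\<exists>(x\<up>1 \<^bold>= pair (y\<up>1) (Var 0)))
     \<^bold>\<or> (e \<^bold>= pair (num 4) \<^bold>0 \<^bold>\<and> \<^bold>\<exists>(x\<up>1 \<^bold>= pair (Var 0) (y\<up>1)))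
     \<^bold>\<or> (e \<^bold>= pair (num 5) \<^bold>0 \<^bold>\<and> ((x \<^bold>\<in> X \<^bold>\<and> y \<^bold>= \<^bold>1) \<^bold>\<or> (\<^bold>\<not>(x \<^bold>\<in> X) \<^bold>\<and> y \<^bold>= \<^bold>0)))
     \<^bold>\<or> \<^bold>\<exists>\<^bold>\<exists>\<^bold>\<exists>\<^bold>\<exists>(let a = Var 3; b = Var 2; u = Var 1; v = Var 0 in
          e\<up>4 \<^bold>= triple (num 6) a b \<^bold>\<and> y\<up>4 \<^bold>= pair u v
          \<^bold>\<and> earlier (s\<up>4) (j\<up>4) a (x\<up>4) u \<^bold>\<and> earlier (s\<up>4) (j\<up>4) b (x\<up>4) v)
     \<^bold>\<or> \<^bold>\<exists>\<^bold>\<exists>\<^bold>\<exists>(let a = Var 2; b = Var 1; z = Var 0 in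
          e\<up>3 \<^bold>= triple (num 7) a b
          \<^bold>\<and> earlier (s\<up>3) (j\<up>3) b (x\<up>3) z \<^bold>\<and> earlier (s\<up>3) (j\<up>3) a z (y\<up>3))
     \<^bold>\<or> \<^bold>\<exists>\<^bold>\<exists>\<^bold>\<exists>(let a = Var 2; b = Var 1; u = Var 0 in
          e\<up>3 \<^bold>= triple (num 8) a b \<^bold>\<and> x\<up>3 \<^bold>= pair u \<^bold>0 \<^bold>\<and> earlier (s\<up>3) (j\<up>3) a u (y\<up>3))
     \<^bold>\<or> \<^bold>\<exists>\<^bold>\<exists>\<^bold>\<exists>\<^bold>\<exists>\<^bold>\<exists>(let a = Var 4; b = Var 3; u = Var 2; k = Var 1; v = Var 0 in
          e\<up>5 \<^bold>= triple (num 8) a b \<^bold>\<and> x\<up>5 \<^bold>= pair u (k \<^bold>+ \<^bold>1)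
          \<^bold>\<and> earlier (s\<up>5) (j\<up>5) (e\<up>5) (pair u k) v
          \<^bold>\<and> earlier (s\<up>5) (j\<up>5) b (triple u k v) (y\<up>5))
     \<^bold>\<or> \<^bold>\<exists>(e\<up>1 \<^bold>= pair (num 9) (Var 0)
          \<^bold>\<and> earlier (s\<up>1) (j\<up>1) (Var 0) (pair (x\<up>1) (y\<up>1)) \<^bold>0
          \<^bold>\<and> \<^bold>\<forall>(Var 0 \<^bold>< y\<up>2 \<^bold>\<longrightarrow> \<^bold>\<exists>(let a = Var 2; z = Var 1; w = Var 0 in
               \<^bold>\<not>(w \<^bold>= \<^bold>0) \<^bold>\<and> earlier (s\<up>3) (j\<up>3) a (pair (x\<up>3) z) w))))"

definition computation :: "nat \<Rightarrow> tm \<Rightarrow> tm \<Rightarrow> fm" where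
  "computation X s l =
    (seq s l
     \<^bold>\<and> \<^bold>\<forall>(Var 0 \<^bold>< l\<up>1 \<^bold>\<longrightarrow> \<^bold>\<exists>\<^bold>\<exists>\<^bold>\<exists>(let j = Var 3; e = Var 2; x = Var 1; y = Var 0 in
          entry (s\<up>4) j (triple e x y) \<^bold>\<and> justified X (s\<up>4) j e x y)))"

text \<open>\<open>\<Phi>\<^sub>e\<^sup>X(x)\<close> is defined and equal to \<open>y\<close>.\<close>

definition Phi :: "nat \<Rightarrow> tm \<Rightarrow> tm \<Rightarrow> tm \<Rightarrow> fm" where
  "Phi X e x y = (\<^bold>\<exists>\<^bold>\<exists>(let s = Var 1; l = Var 0 in
    computation X s l \<^bold>\<and> earlier s l (e\<up>2) (x\<up>2) (y\<up>2)))"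

definition DNR :: fm where
  "DNR = (\<^bold>\<forall>\<^sub>2\<^bold>\<exists>\<^sub>2(let X = 1; f = 0 in
    func f \<^bold>\<and> \<^bold>\<forall>\<^bold>\<forall>(let e = Var 1; y = Var 0 in pair e y \<^bold>\<in> f \<^bold>\<longrightarrow> \<^bold>\<not>(Phi X e e y))))"


section \<open>Ramsey-type weak Koenig lemma\<close>

text \<open>\<open>s\<close> is the code of a binary string of length \<open>l\<close>.\<close>

definition bin_string :: "tm \<Rightarrow> tm \<Rightarrow> fm" where
  "bin_string s l =
    (seq s l
     \<^bold>\<and> \<^bold>\<forall>(Var 0 \<^bold>< l\<up>1 \<^bold>\<longrightarrow> entry (s\<up>1) (Var 0) \<^bold>0 \<^bold>\<or> entry (s\<up>1) (Var 0) \<^bold>1))"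

definition initial_segment :: "tm \<Rightarrow> tm \<Rightarrow> fm" where
  "initial_segment s t = (\<^bold>\<exists>\<^bold>\<exists>(let k = Var 1; l = Var 0 in
    seq (s\<up>2) k \<^bold>\<and> seq (t\<up>2) l \<^bold>\<and> k \<^bold>\<le> l
    \<^bold>\<and> \<^bold>\<forall>\<^bold>\<forall>(let k = Var 3; i = Var 1; x = Var 0 in
         i \<^bold>< k \<^bold>\<and> entry (s\<up>4) i x \<^bold>\<longrightarrow> entry (t\<up>4) i x)))"

definition bin_tree :: "nat \<Rightarrow> fm" where
  "bin_tree T =
    (\<^bold>\<forall>(Var 0 \<^bold>\<in> T \<^bold>\<longrightarrow> \<^bold>\<exists>(bin_string (Var 1) (Var 0)))
     \<^bold>\<and> \<^bold>\<forall>\<^bold>\<forall>(Var 1 \<^bold>\<in> T \<^bold>\<and> initial_segment (Var 0) (Var 1) \<^bold>\<longrightarrow> Var 0 \<^bold>\<in> T))"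

text \<open>
  Infinitely, that is, unboundedly many values of the number variable 0 satisfy \<open>p\<close>; this is the
  definition of infinity inside a possibly nonstandard model.
\<close>

definition Inf_many :: "fm \<Rightarrow> fm"  ("\<^bold>\<exists>\<^sub>\<infinity>_" [40] 40) where
  "Inf_many p = (\<^bold>\<forall>\<^bold>\<exists>(Var 1 \<^bold>\<le> Var 0 \<^bold>\<and> subst (case_nat (Var 0) (\<lambda>i. Var (i + 2))) id p))"

definition hom_string :: "nat \<Rightarrow> tm \<Rightarrow> fm" where
  "hom_string H s = (\<^bold>\<exists>\<^bold>\<exists>(let l = Var 1; c = Var 0 in
    seq (s\<up>2) l \<^bold>\<and> c \<^bold>< num 2
    \<^bold>\<and> \<^bold>\<forall>(let l = Var 2; c = Var 1; i = Var 0 in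
         i \<^bold>\<in> H \<^bold>\<longrightarrow> i \<^bold>< l \<^bold>\<longrightarrow> entry (s\<up>3) i c)))"

definition hom_tree :: "nat \<Rightarrow> nat \<Rightarrow> fm" where
  "hom_tree H T = (\<^bold>\<exists>\<^sub>\<infinity>(Var 0 \<^bold>\<in> T \<^bold>\<and> hom_string H (Var 0)))"

definition RWKL :: fm where
  "RWKL = (\<^bold>\<forall>\<^sub>2(bin_tree 0 \<^bold>\<and> \<^bold>\<exists>\<^sub>\<infinity>(Var 0 \<^bold>\<in> 0) \<^bold>\<longrightarrow>
    \<^bold>\<exists>\<^sub>2(let T = 1; H = 0 in \<^bold>\<exists>\<^sub>\<infinity>(Var 0 \<^bold>\<in> H) \<^bold>\<and> hom_tree H T)))"

end

theory Submission
  imports Defs "HOL-Probability.Probability"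
begin

text \<open>
  The separation is witnessed by a model whose numbers are the standard ones. Its sets depend on two
  parameters: an infinite sequence \<open>h\<close> of \<^emph>\<open>parity constraints\<close> \<open>(i, j, b)\<close>, each saying that a
  two-colouring gives \<open>i\<close> and \<open>j\<close> different colours iff \<open>b\<close>, and a random function \<open>w\<close>. From \<open>h\<close> one
  reads off the tree of all binary strings that satisfy the constraints listed before the stage that
  is their length, and the columns of \<open>w\<close> are functions \<open>f\<^sub>0, f\<^sub>1, \<dots>\<close>. The model consists of
  everything that arises from the tree and the graphs of the \<open>f\<^sub>i\<close> by iterated \<open>\<Delta>\<^sup>0\<^sub>1\<close>
  comprehension, so that it satisfies \<open>RCA\<^sub>0\<close> (\<open>sat_RCA0\<close>). Each of its sets has one of countably many
  names, and whether a number belongs to it is settled by finitely many values of \<open>h\<close> and \<open>w\<close>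
  (\<open>denot_finite_use\<close>). This finite use is all that remains of computability in the argument: as
  the tree is itself a set of the model, its construction can ask noneffective questions.

  \<^emph>\<open>DNR holds.\<close> A name mentions only finitely many columns. If \<open>X\<close> is its set and \<open>f\<^sub>i\<close> is another
  column, then \<open>f\<^sub>i(e)\<close> is independent of the at most one value of \<open>\<Phi>\<^sub>e\<^sup>X(e)\<close> and hits it with probability
  at most \<open>2\<^sup>-\<^sup>(\<^sup>i\<^sup>+\<^sup>e\<^sup>)\<close>. These bounds are summable, and hence almost surely some \<open>f\<^sub>i\<close> is
  diagonally nonrecursive relative to \<open>X\<close> (\<open>AE_diagonal_nonrecursive\<close>).

  \<^emph>\<open>RWKL fails.\<close> A set with two elements to which some constraints force opposite colours is not
  homogeneous for the tree. The sequence \<open>h\<close> is built by finite extension such that, for every name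
  and almost every \<open>w\<close>, an infinite set with that name has two such elements (\<open>AE_killed\<close>). At one step
  the constraints are extended by constraints on numbers not mentioned before, in such a way that the
  probability that a given name is killed, that is, has two opposite elements already because of
  finite parts of \<open>h\<close> and \<open>w\<close>, is within \<open>\<epsilon>\<close> of the supremum over all further extensions of this kind.
  Afterwards the name is infinite and not killed with probability at most \<open>2\<epsilon>\<close>. Indeed, the
  completed sequence relates numbers only within finite blocks, and therefore an infinite set has two
  elements in different blocks. If this had probability above \<open>2\<epsilon>\<close>, some finite part of \<open>h\<close> would
  witness it. Now merge all blocks beyond the earlier numbers along a random colouring
  that satisfies the constraints so far: the two elements become opposite with probability one half, and so some colouring raises
  the probability of being killed by more than \<open>\<epsilon>\<close> (\<open>ex_merge\<close>), a contradiction.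

  Constraints between two numbers cannot be replaced by colours of single numbers. If the tree fixed
  the colours of infinitely many numbers, visibly at finite levels, then the model would contain an
  infinite set of numbers with the same fixed colour, which is homogeneous. For the same reason the
  blocks have to be finite.
\<close>

section \<open>Truth in a class of sets of natural numbers\<close>

primrec teval :: "(nat \<Rightarrow> nat) \<Rightarrow> tm \<Rightarrow> nat" where
  "teval v (Var i) = v i"
| "teval v \<^bold>0 = 0"
| "teval v \<^bold>1 = 1"
| "teval v (s \<^bold>+ t) = teval v s + teval v t"
| "teval v (s \<^bold>* t) = teval v s * teval v t"

primrec sat :: "nat set set \<Rightarrow> (nat \<Rightarrow> nat) \<Rightarrow> (nat \<Rightarrow> nat set) \<Rightarrow> fm \<Rightarrow> bool" where
  "sat M v V \<^bold>\<bottom> \<longleftrightarrow> False"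
| "sat M v V (s \<^bold>= t) \<longleftrightarrow> teval v s = teval v t"
| "sat M v V (s \<^bold>< t) \<longleftrightarrow> teval v s < teval v t"
| "sat M v V (t \<^bold>\<in> X) \<longleftrightarrow> teval v t \<in> V X"
| "sat M v V (p \<^bold>\<longrightarrow> q) \<longleftrightarrow> (sat M v V p \<longrightarrow> sat M v V q)"
| "sat M v V (\<^bold>\<forall>p) \<longleftrightarrow> (\<forall>x. sat M (case_nat x v) V p)"
| "sat M v V (\<^bold>\<forall>\<^sub>2p) \<longleftrightarrow> (\<forall>A\<in>M. sat M v (case_nat A V) p)"

lemma sat_connectives [simp]:
  "sat M v V (\<^bold>\<not>p) \<longleftrightarrow> \<not> sat M v V p"
  "sat M v V (p \<^bold>\<or> q) \<longleftrightarrow> sat M v V p \<or> sat M v V q"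
  "sat M v V (p \<^bold>\<and> q) \<longleftrightarrow> sat M v V p \<and> sat M v V q"
  "sat M v V (p \<^bold>\<longleftrightarrow> q) \<longleftrightarrow> (sat M v V p \<longleftrightarrow> sat M v V q)"
  "sat M v V (\<^bold>\<exists>p) \<longleftrightarrow> (\<exists>x. sat M (case_nat x v) V p)"
  "sat M v V (\<^bold>\<exists>\<^sub>2p) \<longleftrightarrow> (\<exists>A\<in>M. sat M v (case_nat A V) p)"
  by (auto simp: Neg_def Dis_def Con_def Iff_def Defs.Ex_def SEx_def)

lemma teval_tsubst [simp]: "teval v (tsubst \<sigma> t) = teval (\<lambda>i. teval v (\<sigma> i)) t"
  by (induction t) auto

lemma teval_lift [simp]: "teval v (t \<up> n) = teval (\<lambda>i. v (i + n)) t"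
  by (simp add: lift_def)

lemma sat_subst [simp]:
  "sat M v V (subst \<sigma> \<rho> p) \<longleftrightarrow> sat M (\<lambda>i. teval v (\<sigma> i)) (\<lambda>i. V (\<rho> i)) p"
proof (induction p arbitrary: v V \<sigma> \<rho>)
  case (All p)
  have "(\<lambda>i. teval (case_nat x v) (case_nat (Var 0) (\<lambda>i. \<sigma> i \<up> 1) i))
      = case_nat x (\<lambda>i. teval v (\<sigma> i))" for x
    by (auto split: nat.split)
  then show ?case by (simp only: subst.simps sat.simps All)
next
  case (SAll p)
  have "(\<lambda>i. case_nat A V (case_nat 0 (\<lambda>i. Suc (\<rho> i)) i)) = case_nat A (\<lambda>i. V (\<rho> i))"
    for A :: "nat set"
    by (rule ext) (simp split: nat.split)
  then show ?case by (simp only: subst.simps sat.simps SAll)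
qed auto

lemma sat_inst: "sat M v V (inst t p) \<longleftrightarrow> sat M (case_nat (teval v t) v) V p"
proof -
  have "(\<lambda>i. teval v (case_nat t Var i)) = case_nat (teval v t) v"
    by (auto split: nat.split)
  then show ?thesis by simp
qed

lemma sat_sinst: "sat M v V (sinst X p) \<longleftrightarrow> sat M v (case_nat (V X) V) p"
proof -
  have "(\<lambda>i. V (case_nat X id i)) = case_nat (V X) V"
    by (rule ext) (simp split: nat.split)
  then show ?thesis by (simp only: sat_subst teval.simps)
qed

text \<open>
  Set variables range over \<open>M\<close>, and instantiating a set quantifier with one of them is sound
  because the environment maps it to a member of \<open>M\<close>.
\<close>

theorem soundness:
  assumes "\<Gamma> \<turnstile> p" and "range V \<subseteq> M" and "\<forall>q\<in>\<Gamma>. sat M v V q"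
  shows "sat M v V p"
  using assms
proof (induction arbitrary: v V rule: provable.induct)
  case (AllE \<Gamma> p t)
  then show ?case unfolding sat_inst by simp
next
  case (SAllE \<Gamma> p X)
  then show ?case unfolding sat_sinst by (meson rangeI sat.simps(7) subsetD)
next
  case (EqSubst \<Gamma> s t p)
  then show ?case unfolding sat_inst by auto
next
  case (AllI \<Gamma> p)
  then show ?case by simp
next
  case (SAllI \<Gamma> p)
  have "range (case_nat A V) \<subseteq> M" if "A \<in> M" for A
    using SAllI.prems(1) that by (simp add: image_subset_iff split: nat.split)
  then show ?case using SAllI by simp
qed auto

text \<open>
  Environments with finitely many values other than \<open>0\<close> and \<open>{}\<close>. They suffice to evaluate a
  universal closure in the environment without any such value.
\<close>

definition nenv :: "nat list \<Rightarrow> nat \<Rightarrow> nat" where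
  "nenv ns i = (if i < length ns then ns ! i else 0)"

definition senv :: "nat set list \<Rightarrow> nat \<Rightarrow> nat set" where
  "senv As i = (if i < length As then As ! i else {})"

lemma case_nat_nenv [simp]: "case_nat x (nenv ns) = nenv (x # ns)"
  by (auto simp: nenv_def split: nat.split)

lemma case_nat_senv [simp]: "case_nat A (senv As) = senv (A # As)"
  by (rule ext) (simp add: senv_def split: nat.split)

lemma sat_universal_closure:
  assumes "q \<in> universal_closures p"
    and p: "\<And>ns As. set As \<subseteq> M \<Longrightarrow> sat M (nenv ns) (senv As) p"
  shows "sat M (nenv []) (senv []) q"
proof -
  obtain n m where q: "q = (SAll ^^ m) ((All ^^ n) p)"
    using assms(1) by (auto simp: universal_closures_def)
  have 1: "sat M (nenv ns) (senv As) ((All ^^ n) p)" if "set As \<subseteq> M" for n ns As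
  proof (induction n arbitrary: ns)
    case 0
    then show ?case using p that by simp
  qed simp
  have "sat M (nenv []) (senv As) ((SAll ^^ m) ((All ^^ n) p))" if "set As \<subseteq> M" for m As
    using that by (induction m arbitrary: As) (simp_all add: 1)
  from this[of "[]"] show ?thesis unfolding q by simp
qed

section \<open>Arithmetic of the coding\<close>

definition pr :: "nat \<Rightarrow> nat \<Rightarrow> nat" where
  "pr i j = (i + j) * (i + j) + i"

lemma pr_inject [simp]: "pr i j = pr i' j' \<longleftrightarrow> i = i' \<and> j = j'"
proof
  assume eq: "pr i j = pr i' j'"
  have *: "False" if "pr a b = pr a' b'" "a + b < a' + b'" for a b a' b'
  proof -
    have "pr a b < (a + b + 1) * (a + b + 1)" by (simp add: pr_def algebra_simps)
    also have "\<dots> \<le> (a' + b') * (a' + b')" using that by (intro mult_mono) auto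
    also have "\<dots> \<le> pr a' b'" by (simp add: pr_def)
    finally show False using that by simp
  qed
  have "i + j = i' + j'" using *[OF eq] *[OF eq[symmetric]] by (meson linorder_neqE_nat)
  then show "i = i' \<and> j = j'" using eq by (simp add: pr_def)
qed simp

lemma teval_pair [simp]: "teval v (pair s t) = pr (teval v s) (teval v t)"
  by (simp add: pair_def pr_def)

lemma teval_triple [simp]: "teval v (triple s t u) = pr (teval v s) (pr (teval v t) (teval v u))"
  by (simp add: triple_def)

lemma teval_num [simp]: "teval v (num n) = n"
  by (induction n) auto

definition elems :: "nat \<Rightarrow> nat set" where
  "elems c = {i. \<exists>k m n. c = pr k (pr m n) \<and> i < k \<and> m * (i + 1) + 1 dvd n}"

lemma sat_in_code [simp]: "sat M v V (in_code i c) \<longleftrightarrow> teval v i \<in> elems (teval v c)"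
  by (simp add: in_code_def Dvd_def elems_def Let_def numeral_eq_Suc dvd_def)

text \<open>
  This is the arithmetic behind the beta function: the moduli \<open>k! \<cdot> (i + 1) + 1\<close> for \<open>i < k\<close> are pairwise coprime, so that a product of some of them
  is divisible by exactly these.
\<close>

lemma coprime_moduli:
  assumes "i < j" "j < k"
  shows "coprime (fact k * (i + 1) + 1 :: nat) (fact k * (j + 1) + 1)"
proof (rule ccontr)
  assume "\<not> ?thesis"
  then have "gcd (fact k * (i + 1) + 1) (fact k * (j + 1) + 1) \<noteq> (1 :: nat)"
    by (simp only: coprime_iff_gcd_eq_1 not_False_eq_True)
  then obtain p :: nat where "prime p" "p dvd gcd (fact k * (i + 1) + 1) (fact k * (j + 1) + 1)"
    using prime_factor_nat by blast
  then have p: "prime p" "p dvd fact k * (i + 1) + 1" "p dvd fact k * (j + 1) + 1"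
    by (simp_all only: gcd_greatest_iff)
  have "p dvd (fact k * (j + 1) + 1) - (fact k * (i + 1) + 1)"
    using p dvd_diff_nat by blast
  also have "(fact k * (j + 1) + 1) - (fact k * (i + 1) + 1) = fact k * (j - i)"
    by (simp add: diff_mult_distrib2 algebra_simps)
  finally have "p dvd fact k \<or> p dvd j - i"
    using p(1) prime_dvd_mult_iff by blast
  moreover have "j - i dvd fact k"
    using assms by (intro dvd_fact) auto
  ultimately have "p dvd fact k" by (meson dvd_trans)
  then have "p dvd 1"
    using p(2) by (metis dvd_add_right_iff dvd_mult2)
  then show False using p(1) by simp
qed

lemma ex_elems_eq:
  assumes "finite A"
  shows "\<exists>c. elems c = A"
proof -
  obtain k where k: "\<forall>i\<in>A. i < k"
    using assms finite_nat_set_iff_bounded by blast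
  define d where "d i = (fact k * (i + 1) + 1 :: nat)" for i
  have "elems (pr k (pr (fact k) (\<Prod>i\<in>A. d i))) = {i. i < k \<and> d i dvd (\<Prod>i\<in>A. d i)}"
    by (auto simp: elems_def d_def)
  also have "\<dots> = A"
  proof (intro set_eqI iffI)
    fix j assume "j \<in> {i. i < k \<and> d i dvd (\<Prod>i\<in>A. d i)}"
    then have j: "j < k" "d j dvd (\<Prod>i\<in>A. d i)" by auto
    show "j \<in> A"
    proof (rule ccontr)
      assume "j \<notin> A"
      have "coprime (d j) (d i)" if "i \<in> A" for i
      proof -
        have "i < k" "i \<noteq> j" using that k \<open>j \<notin> A\<close> by auto
        then show ?thesis unfolding d_def
          using coprime_moduli[of i j k] coprime_moduli[of j i k] j(1)
          by (metis coprime_commute linorder_neqE_nat)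
      qed
      then have "coprime (d j) (\<Prod>i\<in>A. d i)" by (intro prod_coprime_right) auto
      then have "d j = 1" using j(2) by (simp add: coprime_absorb_left)
      then show False by (simp add: d_def)
    qed
  qed (use assms k in auto)
  finally show ?thesis by blast
qed

definition is_code :: "nat \<Rightarrow> bool" where
  "is_code c \<longleftrightarrow> (\<forall>c'<c. elems c' \<noteq> elems c)"

definition code :: "nat set \<Rightarrow> nat" where
  "code A = (LEAST c. elems c = A)"

lemma elems_code [simp]: "finite A \<Longrightarrow> elems (code A) = A"
  unfolding code_def using ex_elems_eq LeastI_ex by (metis (mono_tags, lifting))

lemma is_code_code [simp]: "finite A \<Longrightarrow> is_code (code A)"
  unfolding is_code_def using not_less_Least[of _ "\<lambda>c. elems c = A"]
  by (simp add: code_def[symmetric])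

lemma is_code_inject:
  assumes "is_code c" "is_code c'" "elems c = elems c'"
  shows "c = c'"
  using assms unfolding is_code_def by (metis linorder_neqE_nat)

lemma sat_fin_code [simp]: "sat M v V (fin_code c) \<longleftrightarrow> is_code (teval v c)"
  by (auto simp: fin_code_def is_code_def numeral_eq_Suc)

lemma sat_entry [simp]:
  "sat M v V (entry s i x) \<longleftrightarrow> pr (teval v i) (teval v x) \<in> elems (teval v s)"
  by (simp add: entry_def)

lemma sat_Le [simp]: "sat M v V (s \<^bold>\<le> t) \<longleftrightarrow> teval v s \<le> teval v t"
  by (auto simp: Le_def)

definition is_seq :: "nat \<Rightarrow> nat \<Rightarrow> bool" where
  "is_seq s l \<longleftrightarrow> is_code s \<and> (\<forall>p\<in>elems s. \<exists>i x. i < l \<and> p = pr i x)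
    \<and> (\<forall>i<l. \<exists>!x. pr i x \<in> elems s)"

lemma sat_seq [simp]: "sat M v V (seq s l) \<longleftrightarrow> is_seq (teval v s) (teval v l)"
  by (simp add: seq_def is_seq_def numeral_eq_Suc Let_def Ex1_def Ball_def)

section \<open>Codes of binary strings\<close>

definition scode :: "bool list \<Rightarrow> nat" where
  "scode \<sigma> = code ((\<lambda>i. pr i (of_bool (\<sigma> ! i))) ` {..<length \<sigma>})"

lemma elems_scode: "elems (scode \<sigma>) = (\<lambda>i. pr i (of_bool (\<sigma> ! i))) ` {..<length \<sigma>}"
  by (simp add: scode_def)

lemma pr_in_elems_scode [simp]:
  "pr i x \<in> elems (scode \<sigma>) \<longleftrightarrow> i < length \<sigma> \<and> x = of_bool (\<sigma> ! i)"
  by (auto simp: elems_scode)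

lemma is_code_scode [simp]: "is_code (scode \<sigma>)"
  by (simp add: scode_def)

lemma is_seq_scode [simp]: "is_seq (scode \<sigma>) l \<longleftrightarrow> l = length \<sigma>"
proof
  assume l: "is_seq (scode \<sigma>) l"
  have "i < length \<sigma>" if "i < l" for i
    using l that unfolding is_seq_def by auto
  moreover have "i < l" if "i < length \<sigma>" for i
  proof -
    have "pr i (of_bool (\<sigma> ! i)) \<in> elems (scode \<sigma>)" using that by simp
    then show ?thesis using l unfolding is_seq_def by fastforce
  qed
  ultimately show "l = length \<sigma>" by (metis linorder_neqE_nat order_less_irrefl)
next
  assume "l = length \<sigma>"
  then show "is_seq (scode \<sigma>) l" by (auto simp: is_seq_def elems_scode)
qed

lemma is_seq_eqI:
  assumes "is_seq s k" "is_seq t k" "\<And>i x. i < k \<Longrightarrow> pr i x \<in> elems s \<Longrightarrow> pr i x \<in> elems t"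
  shows "s = t"
proof (rule is_code_inject)
  have "pr i x \<in> elems s" if "pr i x \<in> elems t" "i < k" for i x
    using assms that unfolding is_seq_def by metis
  then show "elems s = elems t"
    using assms unfolding is_seq_def by (metis subsetI subset_antisym)
qed (use assms in \<open>auto simp: is_seq_def\<close>)

lemma inj_scode: "inj scode"
proof
  fix \<sigma> \<tau> assume eq: "scode \<sigma> = scode \<tau>"
  have len: "length \<sigma> = length \<tau>"
    using is_seq_scode[of \<sigma>] is_seq_scode[of \<tau>] unfolding eq by metis
  have "\<sigma> ! i = \<tau> ! i" if "i < length \<sigma>" for i
    using pr_in_elems_scode[of i "of_bool (\<sigma> ! i)" \<sigma>] that unfolding eq by (simp add: of_bool_eq_iff)
  then show "\<sigma> = \<tau>" using len by (simp add: list_eq_iff_nth_eq)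
qed

section \<open>Trees of parity constraints\<close>

text \<open>
  The constraint \<open>(i, j, b)\<close> demands that \<open>i\<close> and \<open>j\<close> get different colours iff \<open>b\<close>. The colourings
  that satisfy a list of constraints form an affine space over the field with two elements.
\<close>

type_synonym constr = "nat \<times> nat \<times> bool"

definition colourings :: "constr list \<Rightarrow> (nat \<Rightarrow> bool) set" where
  "colourings c = {\<xi>. \<forall>(i, j, b)\<in>set c. (\<xi> i \<noteq> \<xi> j) = b}"

definition opposite :: "constr list \<Rightarrow> nat \<Rightarrow> nat \<Rightarrow> bool" where
  "opposite c i j \<longleftrightarrow> (\<forall>\<xi>\<in>colourings c. \<xi> i \<noteq> \<xi> j)"

definition prefix_of :: "(nat \<Rightarrow> 'a) \<Rightarrow> nat \<Rightarrow> 'a list" where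
  "prefix_of h n = map h [0..<n]"

text \<open>
  A string obeys the constraint \<open>h l\<close> only if it is longer than \<open>l\<close>. Hence the strings up to a given
  length depend on finitely many constraints, and further ones can be imposed later even if
  they prune nodes that the tree contains already.
\<close>

definition ptree :: "(nat \<Rightarrow> constr) \<Rightarrow> bool list set" where
  "ptree h = {\<sigma>. \<forall>l i j b. l < length \<sigma> \<longrightarrow> h l = (i, j, b) \<longrightarrow> i < length \<sigma> \<longrightarrow> j < length \<sigma>
    \<longrightarrow> (\<sigma> ! i \<noteq> \<sigma> ! j) = b}"

lemma set_prefix_of [simp]: "set (prefix_of h n) = h ` {..<n}"
  by (auto simp: prefix_of_def)

lemma length_prefix_of [simp]: "length (prefix_of h n) = n"
  by (simp add: prefix_of_def)

lemma take_in_ptree: "\<sigma> \<in> ptree h \<Longrightarrow> take k \<sigma> \<in> ptree h"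
  by (auto simp: ptree_def)

lemma colouringsD: "\<xi> \<in> colourings c \<Longrightarrow> (i, j, b) \<in> set c \<Longrightarrow> (\<xi> i \<noteq> \<xi> j) = b"
  unfolding colourings_def by blast

lemma colouringsI: "(\<And>i j b. (i, j, b) \<in> set c \<Longrightarrow> (\<xi> i \<noteq> \<xi> j) = b) \<Longrightarrow> \<xi> \<in> colourings c"
  unfolding colourings_def by blast

lemma ptreeD:
  "\<sigma> \<in> ptree h \<Longrightarrow> h l = (i, j, b) \<Longrightarrow> l < length \<sigma> \<Longrightarrow> i < length \<sigma> \<Longrightarrow> j < length \<sigma>
    \<Longrightarrow> (\<sigma> ! i \<noteq> \<sigma> ! j) = b"
  unfolding ptree_def by blast

lemma colouring_in_ptree:
  assumes "\<xi> \<in> colourings (prefix_of h n)"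
  shows "map \<xi> [0..<n] \<in> ptree h"
proof -
  have "(\<xi> i \<noteq> \<xi> j) = b" if "l < n" "h l = (i, j, b)" for l i j b
  proof (rule colouringsD[OF assms])
    show "(i, j, b) \<in> set (prefix_of h n)" using that by (metis image_eqI lessThan_iff set_prefix_of)
  qed
  then show ?thesis by (simp add: ptree_def)
qed

text \<open>
  A string of the tree that is long enough to mention all numbers in the first \<open>n\<close> constraints
  satisfies these, and so does its extension to a colouring by any values beyond its length.
\<close>

lemma opposite_in_ptree:
  assumes "opposite (prefix_of h n) i j"
  shows "\<exists>m. \<forall>\<sigma>\<in>ptree h. m \<le> length \<sigma> \<longrightarrow> i < length \<sigma> \<and> j < length \<sigma> \<and> \<sigma> ! i \<noteq> \<sigma> ! j"
proof -
  have "finite ({i, j} \<union> (fst \<circ> h) ` {..<n} \<union> (fst \<circ> snd \<circ> h) ` {..<n})" by simp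
  then obtain m where m: "\<forall>x\<in>{i, j} \<union> (fst \<circ> h) ` {..<n} \<union> (fst \<circ> snd \<circ> h) ` {..<n}. x < m"
    using finite_nat_set_iff_bounded by meson
  have "\<sigma> ! i \<noteq> \<sigma> ! j" if "\<sigma> \<in> ptree h" "max m n \<le> length \<sigma>" for \<sigma>
  proof -
    have "(\<lambda>x. \<sigma> ! x) \<in> colourings (prefix_of h n)"
    proof (rule colouringsI)
      fix a a' b assume "(a, a', b) \<in> set (prefix_of h n)"
      then obtain l where l: "l < n" "h l = (a, a', b)" by auto
      then have "a < m" "a' < m" using m by force+
      then show "(\<sigma> ! a \<noteq> \<sigma> ! a') = b" using that l ptreeD[of \<sigma> h l] by simp
    qed
    then show ?thesis using assms by (simp add: opposite_def)
  qed
  then show ?thesis using m by (intro exI[of _ "max m n"]) auto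
qed

lemma sat_Inf_many [simp]:
  "sat M v V (\<^bold>\<exists>\<^sub>\<infinity>p) \<longleftrightarrow> infinite {x. sat M (case_nat x v) V p}"
proof -
  have "(\<lambda>i. teval (case_nat x (case_nat n v)) (case_nat (Var 0) (\<lambda>i. Var (i + 2)) i)) = case_nat x v"
    for x n by (rule ext) (simp split: nat.split)
  then have "sat M v V (\<^bold>\<exists>\<^sub>\<infinity>p) \<longleftrightarrow> (\<forall>n. \<exists>x\<ge>n. sat M (case_nat x v) V p)"
    unfolding Defs.Inf_many_def sat.simps sat_connectives sat_subst sat_Le id_apply by simp
  then show ?thesis by (simp add: infinite_nat_iff_unbounded_le)
qed

lemma sat_bin_tree_ptree:
  assumes "V T = scode ` ptree h"
  shows "sat M v V (bin_tree T)"
proof -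
  have "s \<in> scode ` ptree h"
    if "\<sigma> \<in> ptree h" "is_seq s k" "k \<le> length \<sigma>"
      "\<And>i x. i < k \<Longrightarrow> pr i x \<in> elems s \<Longrightarrow> pr i x \<in> elems (scode \<sigma>)" for \<sigma> s k
  proof -
    have "s = scode (take k \<sigma>)"
    proof (rule is_seq_eqI[where k = k])
      show "is_seq (scode (take k \<sigma>)) k" using that by simp
      fix i x assume "i < k" "pr i x \<in> elems s"
      then show "pr i x \<in> elems (scode (take k \<sigma>))" using that(3) that(4)[of i x] by simp
    qed (rule that)
    then show ?thesis using that take_in_ptree by blast
  qed
  then show ?thesis
    using assms by (auto simp: bin_tree_def bin_string_def initial_segment_def Let_def numeral_eq_Suc)
qed

text \<open>
  Consistency of all finite parts of \<open>h\<close> makes the tree infinite. If \<open>H\<close> has two opposite elements,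
  then by the previous lemma only strings of bounded length can be constant on \<open>H\<close>.
\<close>

lemma not_sat_RWKL:
  assumes T: "scode ` ptree h \<in> M"
    and cons: "\<And>n. colourings (prefix_of h n) \<noteq> {}"
    and kill: "\<And>H. H \<in> M \<Longrightarrow> infinite H \<Longrightarrow> \<exists>i\<in>H. \<exists>j\<in>H. \<exists>n. opposite (prefix_of h n) i j"
  shows "\<not> sat M v V RWKL"
proof -
  have "infinite (scode ` ptree h)"
  proof -
    have "\<exists>\<sigma>\<in>ptree h. length \<sigma> = n" for n
      using cons[of n] colouring_in_ptree[of _ h n] by (metis ex_in_conv length_map length_upt minus_nat.diff_0)
    then have "range (\<lambda>n. n) \<subseteq> length ` ptree h" by (auto simp: image_iff) metis
    then have "infinite (ptree h)"
      using finite_surj infinite_UNIV_nat by (metis image_ident)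
    then show ?thesis using inj_scode by (metis finite_imageD inj_on_subset top_greatest)
  qed
  moreover have "finite {s \<in> scode ` ptree h. \<exists>l c. is_seq s l \<and> c < 2 \<and> (\<forall>i. i \<in> H \<longrightarrow> i < l \<longrightarrow> pr i c \<in> elems s)}"
    (is "finite ?S") if H: "H \<in> M" "infinite H" for H
  proof -
    obtain i j n where ij: "i \<in> H" "j \<in> H" "opposite (prefix_of h n) i j"
      using kill[OF H] by blast
    then obtain m where
      m: "\<forall>\<sigma>\<in>ptree h. m \<le> length \<sigma> \<longrightarrow> i < length \<sigma> \<and> j < length \<sigma> \<and> \<sigma> ! i \<noteq> \<sigma> ! j"
      using opposite_in_ptree by blast
    have "?S \<subseteq> scode ` {\<sigma>. set \<sigma> \<subseteq> UNIV \<and> length \<sigma> \<le> m}"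
    proof
      fix s assume "s \<in> ?S"
      then obtain \<sigma> l c where s: "s = scode \<sigma>" "\<sigma> \<in> ptree h" "is_seq s l"
        "\<forall>i\<in>H. i < l \<longrightarrow> pr i c \<in> elems s" by blast
      have "\<not> m \<le> length \<sigma>"
      proof
        assume "m \<le> length \<sigma>"
        then have "i < length \<sigma>" "j < length \<sigma>" "\<sigma> ! i \<noteq> \<sigma> ! j" using m s by auto
        moreover have "c = of_bool (\<sigma> ! i)" "c = of_bool (\<sigma> ! j)" 
          using s(1,3) s(4)[rule_format, OF ij(1)] s(4)[rule_format, OF ij(2)] calculation(1,2)
          by simp_all
        ultimately show False by (simp add: of_bool_eq_iff)
      qed
      then show "s \<in> scode ` {\<sigma>. set \<sigma> \<subseteq> UNIV \<and> length \<sigma> \<le> m}" using s by auto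
    qed
    then show ?thesis
      by (rule finite_subset) (intro finite_imageI finite_lists_length_le, simp)
  qed
  ultimately show ?thesis
    using T sat_bin_tree_ptree[where h = h and M = M]
    by (simp add: RWKL_def hom_tree_def hom_string_def Let_def numeral_eq_Suc) (intro bexI[OF _ T], auto)
qed

section \<open>The enumeration of the partial recursive functions\<close>

text \<open>
  The relation \<open>E e x y\<close> stands for the triples \<open>\<Phi>\<^sub>e(x) = y\<close> that occur earlier in a computation.
\<close>

definition justifies :: "nat set \<Rightarrow> (nat \<Rightarrow> nat \<Rightarrow> nat \<Rightarrow> bool) \<Rightarrow> nat \<Rightarrow> nat \<Rightarrow> nat \<Rightarrow> bool" where
  "justifies X E e x y \<longleftrightarrow>
    e = pr 0 0 \<and> y = 0
    \<or> e = pr 1 0 \<and> y = x + 1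
    \<or> e = pr 2 0 \<and> y = x
    \<or> e = pr 3 0 \<and> (\<exists>z. x = pr y z)
    \<or> e = pr 4 0 \<and> (\<exists>z. x = pr z y)
    \<or> e = pr 5 0 \<and> (x \<in> X \<and> y = 1 \<or> x \<notin> X \<and> y = 0)
    \<or> (\<exists>a b u v. e = pr 6 (pr a b) \<and> y = pr u v \<and> E a x u \<and> E b x v)
    \<or> (\<exists>a b z. e = pr 7 (pr a b) \<and> E b x z \<and> E a z y)
    \<or> (\<exists>a b u. e = pr 8 (pr a b) \<and> x = pr u 0 \<and> E a u y)
    \<or> (\<exists>a b u k v. e = pr 8 (pr a b) \<and> x = pr u (k + 1) \<and> E e (pr u k) v
        \<and> E b (pr u (pr k v)) y)
    \<or> (\<exists>a. e = pr 9 a \<and> E a (pr x y) 0 \<and> (\<forall>z<y. \<exists>w. w \<noteq> 0 \<and> E a (pr x z) w))"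

definition listed :: "nat \<Rightarrow> nat \<Rightarrow> nat \<Rightarrow> nat \<Rightarrow> nat \<Rightarrow> bool" where
  "listed s j e x y \<longleftrightarrow> (\<exists>k<j. pr k (pr e (pr x y)) \<in> elems s)"

definition is_computation :: "nat set \<Rightarrow> nat \<Rightarrow> nat \<Rightarrow> bool" where
  "is_computation X s l \<longleftrightarrow> is_seq s l
    \<and> (\<forall>j<l. \<exists>e x y. pr j (pr e (pr x y)) \<in> elems s \<and> justifies X (listed s j) e x y)"

definition phi :: "nat set \<Rightarrow> nat \<Rightarrow> nat \<Rightarrow> nat \<Rightarrow> bool" where
  "phi X e x y \<longleftrightarrow> (\<exists>s l. is_computation X s l \<and> listed s l e x y)"

lemma sat_earlier [simp]:
  "sat M v V (earlier s j e x y)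
    \<longleftrightarrow> listed (teval v s) (teval v j) (teval v e) (teval v x) (teval v y)"
  by (simp add: earlier_def listed_def)

lemma sat_justified [simp]:
  "sat M v V (justified X s j e x y)
    \<longleftrightarrow> justifies (V X) (listed (teval v s) (teval v j)) (teval v e) (teval v x) (teval v y)"
  by (simp add: justified_def justifies_def Let_def numeral_eq_Suc)

lemma sat_computation [simp]:
  "sat M v V (computation X s l) \<longleftrightarrow> is_computation (V X) (teval v s) (teval v l)"
  by (simp add: computation_def is_computation_def Let_def numeral_eq_Suc)

lemma sat_Phi [simp]:
  "sat M v V (Phi X e x y) \<longleftrightarrow> phi (V X) (teval v e) (teval v x) (teval v y)"
  by (simp add: Phi_def phi_def Let_def numeral_eq_Suc)

lemma justifies_unique:
  assumes y: "justifies X E e x y" and y': "justifies X E' e x y'"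
    and E: "\<And>e x y y'. E e x y \<Longrightarrow> E' e x y' \<Longrightarrow> y = y'"
  shows "y = y'"
proof (cases "\<exists>a. e = pr 9 a")
  case True
  then obtain a where a: "e = pr 9 a" by blast
  have 1: "E a (pr x y) 0" "\<And>z. z < y \<Longrightarrow> \<exists>w. w \<noteq> 0 \<and> E a (pr x z) w"
    using y a by (auto simp: justifies_def)
  have 2: "E' a (pr x y') 0" "\<And>z. z < y' \<Longrightarrow> \<exists>w. w \<noteq> 0 \<and> E' a (pr x z) w"
    using y' a by (auto simp: justifies_def)
  show ?thesis
  proof (rule linorder_cases[of y y'])
    assume "y < y'"
    then show ?thesis using 1 2 E by metis
  next
    assume "y' < y"
    then show ?thesis using 1 2 E by metis
  qed
next
  case False
  from y show ?thesis unfolding justifies_def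
    by (elim disjE exE conjE; use y' False in \<open>auto simp: justifies_def dest: E\<close>)
qed

text \<open>
  By induction on the position in the first computation: the entry there is justified by earlier
  entries, with which the second computation agrees, and a justification determines the value.
\<close>

lemma listed_unique:
  assumes s: "is_computation X s l" and s': "is_computation X s' l'"
  shows "\<lbrakk>j \<le> l; listed s j e x y; listed s' l' e x y'\<rbrakk> \<Longrightarrow> y = y'"
proof (induction j arbitrary: e x y y' rule: less_induct)
  case (less j)
  have just: "\<exists>k<j. justifies X (listed s k) e x y"
    if "is_computation X s l" "j \<le> l" "listed s j e x y" for s l j y
  proof -
    obtain k where k: "k < j" "pr k (pr e (pr x y)) \<in> elems s"
      using \<open>listed s j e x y\<close> unfolding listed_def by blast
    have "k < l" using k(1) \<open>j \<le> l\<close> by simp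
    then have "\<exists>!z. pr k z \<in> elems s"
      using \<open>is_computation X s l\<close> unfolding is_computation_def is_seq_def by blast
    moreover obtain e' x' y' where *: "pr k (pr e' (pr x' y')) \<in> elems s"
      "justifies X (listed s k) e' x' y'"
      using \<open>is_computation X s l\<close> \<open>k < l\<close> unfolding is_computation_def by blast
    ultimately have "pr e' (pr x' y') = pr e (pr x y)" using k(2) by blast
    then show ?thesis using * k(1) by auto
  qed
  obtain k where k: "k < j" "justifies X (listed s k) e x y"
    using just[OF s] less.prems by blast
  obtain k' where k': "k' < l'" "justifies X (listed s' k') e x y'"
    using just[OF s'] less.prems by blast
  have "listed s' k' e x y \<Longrightarrow> listed s' l' e x y" for e x y
    using k'(1) unfolding listed_def by (meson order_less_trans)
  then show ?case
    using justifies_unique[OF k(2) k'(2)] less.IH[OF k(1)] k(1) less.prems(1) by simp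
qed

lemma phi_unique: "phi X e x y \<Longrightarrow> phi X e x y' \<Longrightarrow> y = y'"
  unfolding phi_def using listed_unique by blast

lemma sat_DNR:
  assumes "\<And>X. X \<in> M \<Longrightarrow> \<exists>f. (\<lambda>e. pr e (f e)) ` UNIV \<in> M \<and> (\<forall>e. \<not> phi X e e (f e))"
  shows "sat M v V DNR"
proof -
  have *: "\<exists>F\<in>M. (\<forall>p. p \<in> F \<longrightarrow> (\<exists>e y. p = pr e y)) \<and> (\<forall>e. \<exists>y. pr e y \<in> F \<and> (\<forall>z. pr e z \<in> F \<longrightarrow> z = y))
     \<and> (\<forall>e y. pr e y \<in> F \<longrightarrow> \<not> phi X e e y)" if X: "X \<in> M" for X
  proof -
    obtain f where "range (\<lambda>e. pr e (f e)) \<in> M" "\<forall>e. \<not> phi X e e (f e)"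
      using assms[OF X] by blast
    then show ?thesis by (intro bexI[of _ "range (\<lambda>e. pr e (f e))"]) (auto simp: image_iff)
  qed
  show ?thesis
    using * by (simp add: DNR_def func_def Let_def numeral_eq_Suc)
qed

section \<open>Models generated by names\<close>

text \<open>
  A seed consists of the constraint sequence that defines the tree and of the random function. The
  name \<open>Compr p q ns Ns\<close> denotes the set defined by \<open>p\<close> with the number parameters \<open>ns\<close> and the sets
  named by \<open>Ns\<close> as set parameters. It is good for a seed if \<open>p\<close> and \<open>q\<close> witness that this set is
  \<open>\<Delta>\<^sup>0\<^sub>1\<close> in its parameters. Denotations are defined for all names, good or not, which makes them
  measurable functions of the seed; they are continuous only on the seeds for which the name is good.
\<close>

type_synonym seed = "(nat \<Rightarrow> constr) \<times> (nat \<Rightarrow> nat)"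

instance tm :: countable by countable_datatype
instance fm :: countable by countable_datatype

datatype nm = Tree | Fun nat | Compr fm fm "nat list" "nm list"

instance nm :: countable by countable_datatype

primrec denot :: "seed \<Rightarrow> nm \<Rightarrow> nat set" where
  "denot z Tree = scode ` ptree (fst z)"
| "denot z (Fun i) = range (\<lambda>e. pr e (snd z (prod_encode (i, e))))"
| "denot z (Compr p q ns Ns) = {x. sat {} (nenv (x # ns)) (senv (map (denot z) Ns)) p}"

primrec good :: "seed \<Rightarrow> nm \<Rightarrow> bool" where
  "good z Tree \<longleftrightarrow> True"
| "good z (Fun i) \<longleftrightarrow> True"
| "good z (Compr p q ns Ns) \<longleftrightarrow> Sigma1 p \<and> Pi1 q \<and> list_all (good z) Ns \<and>
    (\<forall>x. sat {} (nenv (x # ns)) (senv (map (denot z) Ns)) p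
      \<longleftrightarrow> sat {} (nenv (x # ns)) (senv (map (denot z) Ns)) q)"

definition model :: "seed \<Rightarrow> nat set set" where
  "model z = {denot z N | N. good z N}"

lemma sat_Delta0_cong: "Delta0 p \<Longrightarrow> sat M v V p \<longleftrightarrow> sat M' v V p"
  by (induction p arbitrary: v rule: Delta0.induct) auto

lemma sat_Sigma1_cong: "Sigma1 p \<Longrightarrow> sat M v V p \<longleftrightarrow> sat M' v V p"
  unfolding Sigma1_def by (elim exE conjE) (simp add: sat_Delta0_cong[of _ M _ _ M'])

lemma sat_Pi1_cong: "Pi1 p \<Longrightarrow> sat M v V p \<longleftrightarrow> sat M' v V p"
  unfolding Pi1_def by (elim exE conjE) (simp add: sat_Delta0_cong[of _ M _ _ M'])

lemma empty_in_model: "{} \<in> model z"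
proof -
  have "denot z (Compr (\<^bold>\<exists>\<^bold>\<bottom>) (\<^bold>\<forall>\<^bold>\<bottom>) [] []) = {}" by simp
  moreover have "good z (Compr (\<^bold>\<exists>\<^bold>\<bottom>) (\<^bold>\<forall>\<^bold>\<bottom>) [] [])"
    by (auto simp: Sigma1_def Pi1_def intro: Delta0.intros)
  ultimately show ?thesis unfolding model_def by blast
qed

text \<open>
  The model is closed under \<open>\<Delta>\<^sup>0\<^sub>1\<close> comprehension because its sets are the ones with good names: an
  instance of comprehension either fails in its hypothesis or provides the next name.
\<close>

lemma sat_comprehension_axiom:
  assumes "Sigma1 p" "Pi1 q" "set As \<subseteq> model z"
  shows "sat (model z) (nenv ns) (senv As) (comprehension_axiom p q)"
proof -
  obtain Ns where Ns: "As = map (denot z) Ns" "list_all (good z) Ns"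
  proof -
    have "\<forall>A\<in>set As. \<exists>N. A = denot z N \<and> good z N" using assms(3) by (auto simp: model_def)
    then have "\<exists>f. \<forall>A\<in>set As. A = denot z (f A) \<and> good z (f A)" by (rule bchoice)
    then obtain f where "\<forall>A\<in>set As. A = denot z (f A) \<and> good z (f A)" ..
    then have "As = map (denot z) (map f As)" "list_all (good z) (map f As)"
      by (auto simp: list_all_iff map_idI)
    then show ?thesis using that by blast
  qed
  have p: "sat (model z) v V p = sat {} v V p" and q: "sat (model z) v V q = sat {} v V q" for v V
    using assms sat_Sigma1_cong sat_Pi1_cong by blast+
  show ?thesis
  proof (cases "\<forall>x. sat {} (nenv (x # ns)) (senv As) p \<longleftrightarrow> sat {} (nenv (x # ns)) (senv As) q")
    case True
    then have "denot z (Compr p q ns Ns) \<in> model z"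
      unfolding model_def using assms Ns by (intro CollectI exI[of _ "Compr p q ns Ns"]) auto
    then show ?thesis
      unfolding comprehension_axiom_def sat.simps sat_connectives sat_subst p case_nat_nenv nat.case
      by (intro impI bexI[of _ "denot z (Compr p q ns Ns)"]) (simp_all add: Ns(1) nenv_def[of _ 0])
  next
    case False
    then show ?thesis
      unfolding comprehension_axiom_def sat.simps sat_connectives p q case_nat_nenv by blast
  qed
qed

lemma sat_induction_axiom: "sat M v V (induction_axiom p)"
proof -
  have *: "(\<lambda>i. teval (case_nat x v) (case_nat (Var 0 \<^bold>+ \<^bold>1) (\<lambda>i. Var (Suc i)) i)) = case_nat (Suc x) v"
    for x by (rule ext) (simp split: nat.split)
  have **: "(\<lambda>i. teval v (case_nat \<^bold>0 Var i)) = case_nat 0 v"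
    by (rule ext) (simp split: nat.split)
  have "sat M (case_nat x v) V p" if "sat M (case_nat 0 v) V p"
    "\<And>x. sat M (case_nat x v) V p \<Longrightarrow> sat M (case_nat (Suc x) v) V p" for x
    using that by (induction x) auto
  then show ?thesis
    unfolding induction_axiom_def sat.simps sat_connectives sat_subst * ** id_apply by blast
qed

lemma sat_RCA0:
  assumes "\<phi> \<in> RCA0"
  shows "sat (model z) (nenv []) (senv []) \<phi>"
proof -
  obtain p where p: "\<phi> \<in> universal_closures p"
    "p \<in> basic_axioms \<union> {induction_axiom p | p. Sigma1 p}
      \<union> {comprehension_axiom p q | p q. Sigma1 p \<and> Pi1 q}"
    using assms by (auto simp: RCA0_def)
  have "sat (model z) (nenv ns) (senv As) p" if "set As \<subseteq> model z" for ns As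
    using p(2) that
    by (auto simp: basic_axioms_def sat_induction_axiom sat_comprehension_axiom less_Suc_eq)
  then show ?thesis using sat_universal_closure p(1) by blast
qed

section \<open>Finite use\<close>

definition agree :: "nat \<Rightarrow> seed \<Rightarrow> seed \<Rightarrow> bool" where
  "agree n z z' \<longleftrightarrow> (\<forall>k<n. fst z k = fst z' k \<and> snd z k = snd z' k)"

lemma Delta0_finite_use:
  assumes "Delta0 p"
  shows "\<exists>m. \<forall>V'. (\<forall>X. \<forall>y<m. y \<in> V' X \<longleftrightarrow> y \<in> V X) \<longrightarrow> (sat M v V' p \<longleftrightarrow> sat M v V p)"
  using assms
proof (induction p arbitrary: v rule: Delta0.induct)
  case (4 t X)
  then show ?case by (intro exI[of _ "Suc (teval v t)"]) auto
next
  case (5 p q)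
  obtain a where a: "\<forall>V'. (\<forall>X. \<forall>y<a. y \<in> V' X \<longleftrightarrow> y \<in> V X) \<longrightarrow> (sat M v V' p \<longleftrightarrow> sat M v V p)"
    using 5 by blast
  obtain b where b: "\<forall>V'. (\<forall>X. \<forall>y<b. y \<in> V' X \<longleftrightarrow> y \<in> V X) \<longrightarrow> (sat M v V' q \<longleftrightarrow> sat M v V q)"
    using 5 by blast
  show ?case
  proof (intro exI[of _ "max a b"] allI impI)
    fix V' assume *: "\<forall>X. \<forall>y<max a b. y \<in> V' X \<longleftrightarrow> y \<in> V X"
    show "sat M v V' (p \<^bold>\<longrightarrow> q) \<longleftrightarrow> sat M v V (p \<^bold>\<longrightarrow> q)"
      using a[rule_format, of V'] b[rule_format, of V'] * by simp
  qed
next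
  case (6 p t)
  have "\<forall>x. \<exists>m. \<forall>V'. (\<forall>X. \<forall>y<m. y \<in> V' X \<longleftrightarrow> y \<in> V X)
      \<longrightarrow> (sat M (case_nat x v) V' p \<longleftrightarrow> sat M (case_nat x v) V p)"
    using 6 by blast
  from choice[OF this] obtain f where f: "\<forall>x. \<forall>V'. (\<forall>X. \<forall>y<f x. y \<in> V' X \<longleftrightarrow> y \<in> V X)
      \<longrightarrow> (sat M (case_nat x v) V' p \<longleftrightarrow> sat M (case_nat x v) V p)"
    by blast
  have m: "f x \<le> Max (f ` {..<teval v t})" if "x < teval v t" for x
    using that by simp
  let ?m = "Max (f ` {..<teval v t})"
  show ?case
  proof (intro exI[of _ ?m] allI impI)
    fix V' assume V': "\<forall>X. \<forall>y<?m. y \<in> V' X \<longleftrightarrow> y \<in> V X"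
    have "sat M (case_nat x v) V' p \<longleftrightarrow> sat M (case_nat x v) V p" if "x < teval v t" for x
    proof (rule f[rule_format])
      fix X y assume "y < f x"
      then have "y < ?m" using m[OF that] by simp
      then show "y \<in> V' X \<longleftrightarrow> y \<in> V X" using V' by blast
    qed
    then show "sat M v V' (\<^bold>\<forall>(Var 0 \<^bold>< t \<up> 1 \<^bold>\<longrightarrow> p)) \<longleftrightarrow> sat M v V (\<^bold>\<forall>(Var 0 \<^bold>< t \<up> 1 \<^bold>\<longrightarrow> p))"
      by simp
  qed
qed auto

text \<open>
  On the seeds for which a name is good, its denotation is continuous. For a comprehension,
  membership is witnessed by an instance of the \<open>\<Delta>\<^sub>0\<close> matrix of \<open>p\<close>, and non-membership by a failing
  instance of the matrix of \<open>q\<close>; either instance looks at finitely many elements of the parameters.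
\<close>

theorem denot_finite_use:
  assumes "good z N"
  shows "\<forall>\<^sub>F n in sequentially. \<forall>z'. good z' N \<longrightarrow> agree n z z' \<longrightarrow> (x \<in> denot z' N \<longleftrightarrow> x \<in> denot z N)"
  using assms
proof (induction N arbitrary: x)
  case Tree
  show ?case
  proof (cases "x \<in> range scode")
    case True
    then obtain \<sigma> where x: "x = scode \<sigma>" by blast
    have *: "\<sigma> \<in> ptree h \<longleftrightarrow> \<sigma> \<in> ptree h'" if "\<forall>k<length \<sigma>. h k = h' k" for h h'
      using that by (auto simp: ptree_def)
    have "scode \<sigma> \<in> denot z' Tree \<longleftrightarrow> \<sigma> \<in> ptree (fst z')" for z'
      using inj_scode by (auto dest: injD)
    then show ?thesis unfolding x eventually_sequentially
      using * by (intro exI[of _ "length \<sigma>"]) (simp add: agree_def)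
  qed (auto simp: eventually_sequentially)
next
  case (Fun i)
  show ?case
  proof (cases "\<exists>e y. x = pr e y")
    case True
    then obtain e y where x: "x = pr e y" by blast
    show ?thesis unfolding x eventually_sequentially
      by (intro exI[of _ "Suc (prod_encode (i, e))"]) (auto simp: agree_def image_iff)
  next
    case False
    then have "x \<notin> denot z' (Fun i)" for z' by auto
    then show ?thesis by simp
  qed
next
  case (Compr p q ns Ns)
  define v where "v = nenv (x # ns)"
  define V where "V z = senv (map (denot z) Ns)" for z
  have use: "\<forall>\<^sub>F n in sequentially. \<forall>z'. good z' (Compr p q ns Ns) \<longrightarrow> agree n z z'
      \<longrightarrow> (sat {} u (V z') r \<longleftrightarrow> sat {} u (V z) r)" if r: "Delta0 r" for r u
  proof -
    obtain m where m: "\<forall>V'. (\<forall>X. \<forall>y<m. y \<in> V' X \<longleftrightarrow> y \<in> V z X) \<longrightarrow> (sat {} u V' r \<longleftrightarrow> sat {} u (V z) r)"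
      using Delta0_finite_use[OF r] by blast
    have "\<forall>\<^sub>F n in sequentially. \<forall>N\<in>set Ns. \<forall>y\<in>{..<m}. \<forall>z'. good z' N \<longrightarrow> agree n z z'
        \<longrightarrow> (y \<in> denot z' N \<longleftrightarrow> y \<in> denot z N)"
      using Compr by (intro eventually_ball_finite ballI) (auto simp: list_all_iff)
    then show ?thesis
    proof eventually_elim
      case (elim n)
      show ?case
      proof (intro allI impI)
        fix z' assume z': "good z' (Compr p q ns Ns)" "agree n z z'"
        have "y \<in> V z' X \<longleftrightarrow> y \<in> V z X" if "y < m" for X y
        proof (cases "X < length Ns")
          case True
          moreover have "good z' (Ns ! X)" using z'(1) True by (simp add: list_all_iff)
          ultimately have "y \<in> denot z' (Ns ! X) \<longleftrightarrow> y \<in> denot z (Ns ! X)"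
            using elim z'(2) that nth_mem by blast
          then show ?thesis using True by (simp add: V_def senv_def)
        qed (simp add: V_def senv_def)
        then show "sat {} u (V z') r \<longleftrightarrow> sat {} u (V z) r" using m by blast
      qed
    qed
  qed
  have denot: "x \<in> denot z' (Compr p q ns Ns) \<longleftrightarrow> sat {} v (V z') p" for z'
    by (simp add: v_def V_def)
  have pq: "sat {} v (V z') p \<longleftrightarrow> sat {} v (V z') q" if "good z' (Compr p q ns Ns)" for z'
    using that by (simp add: v_def V_def)
  obtain p0 q0 where p0: "p = (\<^bold>\<exists>p0)" "Delta0 p0" and q0: "q = (\<^bold>\<forall>q0)" "Delta0 q0"
    using Compr.prems by (auto simp: Sigma1_def Pi1_def)
  show ?case
  proof (cases "x \<in> denot z (Compr p q ns Ns)")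
    case True
    then have "sat {} v (V z) p" by (simp only: denot)
    then obtain a where "sat {} (case_nat a v) (V z) p0" unfolding p0(1) by auto
    with use[OF p0(2), of "case_nat a v"]
    have "\<forall>\<^sub>F n in sequentially. \<forall>z'. good z' (Compr p q ns Ns) \<longrightarrow> agree n z z' \<longrightarrow> sat {} v (V z') p"
      unfolding p0(1) sat_connectives by (auto elim!: eventually_mono)
    then show ?thesis using True by (simp only: denot) (auto elim!: eventually_mono)
  next
    case False
    then have "\<not> sat {} v (V z) q" by (simp only: denot pq[OF Compr.prems] not_False_eq_True)
    then obtain a where "\<not> sat {} (case_nat a v) (V z) q0" unfolding q0(1) by auto
    with use[OF q0(2), of "case_nat a v"] 
    have "\<forall>\<^sub>F n in sequentially. \<forall>z'. good z' (Compr p q ns Ns) \<longrightarrow> agree n z z' \<longrightarrow> \<not> sat {} v (V z') q"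
      unfolding q0(1) sat.simps by (auto elim!: eventually_mono)
    then have "\<forall>\<^sub>F n in sequentially. \<forall>z'. good z' (Compr p q ns Ns) \<longrightarrow> agree n z z' \<longrightarrow> \<not> sat {} v (V z') p"
      by (rule eventually_mono) (use pq in blast)
    then show ?thesis using False by (simp only: denot) (auto elim!: eventually_mono)
  qed
qed

section \<open>Random guesses\<close>

text \<open>
  Coordinate \<open>prod_encode (i, e)\<close> is the value at \<open>e\<close> of the \<open>i\<close>-th function. The range of coordinate
  \<open>k\<close> grows so fast that the probabilities of correct guesses are summable.
\<close>

definition guesses :: "(nat \<Rightarrow> nat) measure" where
  "guesses = PiM UNIV (\<lambda>k. measure_pmf (pmf_of_set {..<2 ^ k}))"

interpretation guesses: prob_space guesses
  unfolding guesses_def by (intro prob_space_PiM) (rule prob_space_measure_pmf)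

lemma space_guesses [simp]: "space guesses = UNIV"
  by (simp add: guesses_def space_PiM)

lemma pred_coordinate [measurable]: "Measurable.pred guesses (\<lambda>w. P (w k))"
proof -
  have "(\<lambda>w. w k) \<in> measurable guesses (measure_pmf (pmf_of_set {..<2 ^ k}))"
    unfolding guesses_def by (rule measurable_component_singleton) simp
  then have "(\<lambda>w. w k) \<in> measurable guesses (count_space UNIV)" by simp
  then show ?thesis by measurable
qed

lemma pred_sat:
  assumes "\<And>X x. Measurable.pred guesses (\<lambda>w. x \<in> V w X)"
  shows "Measurable.pred guesses (\<lambda>w. sat {} v (V w) p)"
  by (induction p arbitrary: v) (use assms in \<open>simp_all add: pred_intros_logic pred_intros_countable\<close>)

lemma pred_denot: "Measurable.pred guesses (\<lambda>w. x \<in> denot (h, w) N)"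
proof (induction N arbitrary: x)
  case (Fun i)
  have "Measurable.pred guesses (\<lambda>w. \<exists>e. x = pr e (w (prod_encode (i, e))))"
    by measurable
  then show ?case by (simp add: image_iff)
next
  case (Compr p q ns Ns)
  have "Measurable.pred guesses (\<lambda>w. x \<in> senv (map (denot (h, w)) Ns) X)" for X x
    using Compr[OF nth_mem] by (cases "X < length Ns") (simp_all add: senv_def)
  then show ?case by (simp add: pred_sat)
qed simp

lemma pred_phi: "Measurable.pred guesses (\<lambda>w. phi (denot (h, w) N) e x y)"
proof -
  have "Measurable.pred guesses (\<lambda>w. z \<in> senv [denot (h, w) N] X)" for X z
    using pred_denot by (cases X) (simp_all add: senv_def)
  then have "Measurable.pred guesses
      (\<lambda>w. sat {} (nenv [e, x, y]) (senv [denot (h, w) N]) (Phi 0 (Var 0) (Var 1) (Var 2)))"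
    by (rule pred_sat)
  then show ?thesis by (simp add: nenv_def senv_def)
qed

primrec support :: "nm \<Rightarrow> nat set" where
  "support Tree = {}"
| "support (Fun i) = {i}"
| "support (Compr p q ns Ns) = \<Union> (set (map support Ns))"

lemma finite_support: "finite (support N)"
  by (induction N) auto

lemma denot_support:
  assumes "\<And>i e. i \<in> support N \<Longrightarrow> w (prod_encode (i, e)) = w' (prod_encode (i, e))"
  shows "denot (h, w) N = denot (h, w') N"
  using assms
proof (induction N)
  case (Compr p q ns Ns)
  then have "map (denot (h, w)) Ns = map (denot (h, w')) Ns" by auto
  then show ?case by (simp only: denot.simps)
qed auto

text \<open>
  Drawing one coordinate afresh does not change the distribution. This is the form in which
  independence of a coordinate from all the others is used.
\<close>

lemma emeasure_guesses_resample:
  assumes "Measurable.pred guesses P"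
  shows "emeasure guesses {w. P w}
    = (\<integral>\<^sup>+w. emeasure (measure_pmf (pmf_of_set {..<2 ^ k})) {y. P (w(k := y))} \<partial>guesses)"
proof -
  let ?M = "\<lambda>k. measure_pmf (pmf_of_set {..<2 ^ k :: nat})"
  interpret pair_sigma_finite "?M k" guesses
    by (intro pair_sigma_finite.intro guesses.sigma_finite_measure_axioms
        measure_pmf.sigma_finite_measure_axioms)
  have upd [measurable]: "(\<lambda>(y, w). w(k := y)) \<in> measurable (?M k \<Otimes>\<^sub>M guesses) guesses"
    using measurable_compose[OF measurable_pair_swap' measurable_add_dim[of k UNIV "?M"]]
    unfolding guesses_def by (simp add: split_beta')
  have eq: "distr (?M k \<Otimes>\<^sub>M guesses) guesses (\<lambda>(y, w). w(k := y)) = guesses"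
    using distr_pair_PiM_eq_PiM[of UNIV "?M" k] unfolding guesses_def
    by (simp add: prob_space_measure_pmf)
  have P [measurable]: "{w. P w} \<in> sets guesses"
    using assms by (simp add: pred_def)
  have "emeasure guesses {w. P w} = emeasure (distr (?M k \<Otimes>\<^sub>M guesses) guesses (\<lambda>(y, w). w(k := y))) {w. P w}"
    by (simp only: eq)
  also have "\<dots> = emeasure (?M k \<Otimes>\<^sub>M guesses) ((\<lambda>(y, w). w(k := y)) -` {w. P w} \<inter> space (?M k \<Otimes>\<^sub>M guesses))"
    by (subst emeasure_distr) simp_all
  also have "\<dots> = (\<integral>\<^sup>+w. emeasure (?M k)
      ((\<lambda>y. (y, w)) -` ((\<lambda>(y, w). w(k := y)) -` {w. P w} \<inter> space (?M k \<Otimes>\<^sub>M guesses))) \<partial>guesses)"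
    by (rule emeasure_pair_measure_alt2[OF measurable_sets[OF upd P]])
  also have "\<dots> = (\<integral>\<^sup>+w. emeasure (?M k) {y. P (w(k := y))} \<partial>guesses)"
    by (intro nn_integral_cong arg_cong2[where f = emeasure] refl) (auto simp: space_pair_measure)
  finally show ?thesis .
qed

text \<open>
  If all coordinates but \<open>prod_encode (i, e)\<close> are fixed, then so is the set \<open>X\<close> denoted by \<open>N\<close>, and at
  most one value of the remaining coordinate equals \<open>\<Phi>\<^sub>e\<^sup>X(e)\<close>.
\<close>

lemma prob_correct_guess:
  assumes "i \<notin> support N"
  shows "measure guesses {w. phi (denot (h, w) N) e e (w (prod_encode (i, e)))} \<le> (1 / 2) ^ (i + e)"
proof -
  define k where "k = prod_encode (i, e)"
  let ?M = "measure_pmf (pmf_of_set {..<2 ^ k :: nat})"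
  have pred: "Measurable.pred guesses (\<lambda>w. phi (denot (h, w) N) e e (w k))"
  proof -
    have "Measurable.pred guesses (\<lambda>w. \<exists>y. w k = y \<and> phi (denot (h, w) N) e e y)"
      using pred_phi[measurable] by measurable
    then show ?thesis by simp
  qed
  have single: "emeasure ?M {y} \<le> ennreal ((1 / 2) ^ k)" for y
  proof -
    have "{..<2 ^ k :: nat} \<noteq> {}" using lessThan_empty_iff by fastforce
    then have "pmf (pmf_of_set {..<2 ^ k :: nat}) y = indicator {..<2 ^ k} y * (1 / 2) ^ k"
      by (simp add: pmf_of_set power_one_over)
    also have "\<dots> \<le> (1 / 2) ^ k" by (simp add: indicator_def)
    finally show ?thesis unfolding emeasure_pmf_single by (rule ennreal_leI)
  qed
  have "emeasure ?M {y. phi (denot (h, w(k := y)) N) e e ((w(k := y)) k)} \<le> ennreal ((1 / 2) ^ k)" for w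
  proof -
    have "denot (h, w(k := y)) N = denot (h, w) N" for y
      using assms by (intro denot_support) (auto simp: k_def)
    then have *: "{y. phi (denot (h, w(k := y)) N) e e ((w(k := y)) k)} = {y. phi (denot (h, w) N) e e y}"
      by simp
    show ?thesis
    proof (cases "\<exists>y. phi (denot (h, w) N) e e y")
      case True
      then obtain y where "{y. phi (denot (h, w) N) e e y} = {y}"
        using phi_unique by blast
      then show ?thesis unfolding * using single by simp
    next
      case False
      then have empty: "{y. phi (denot (h, w) N) e e y} = {}" by blast
      show ?thesis unfolding * empty by simp
    qed
  qed
  then have "emeasure guesses {w. phi (denot (h, w) N) e e (w k)} \<le> (\<integral>\<^sup>+w. ennreal ((1 / 2) ^ k) \<partial>guesses)"
    unfolding emeasure_guesses_resample[OF pred, of k] by (intro nn_integral_mono)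
  also have "\<dots> = ennreal ((1 / 2) ^ k)"
    by (simp add: guesses.emeasure_space_1[simplified])
  finally have "measure guesses {w. phi (denot (h, w) N) e e (w k)} \<le> (1 / 2) ^ k"
    by (simp add: guesses.emeasure_eq_measure)
  also have "\<dots> \<le> (1 / 2) ^ (i + e)"
  proof (rule power_decreasing)
    show "i + e \<le> k" unfolding k_def prod_encode_def triangle_def
      by (cases "i + e") auto
  qed auto
  finally show ?thesis by (simp add: k_def)
qed

theorem AE_diagonal_nonrecursive:
  "AE w in guesses. \<forall>N. \<exists>i. \<forall>e. \<not> phi (denot (h, w) N) e e (w (prod_encode (i, e)))"
proof -
  have "AE w in guesses. \<exists>i. \<forall>e. \<not> phi (denot (h, w) N) e e (w (prod_encode (i, e)))" for N
  proof -
    define B where "B i e = {w. phi (denot (h, w) N) e e (w (prod_encode (i, e)))}" for i e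
    have sets_B [measurable]: "B i e \<in> sets guesses" for i e
    proof -
      have "Measurable.pred guesses (\<lambda>w. \<exists>y. w (prod_encode (i, e)) = y \<and> phi (denot (h, w) N) e e y)"
        using pred_phi[measurable] by measurable
      then show ?thesis by (simp add: pred_def B_def)
    qed
    have bound: "measure guesses (\<Inter>i. \<Union>e. B i e) \<le> 2 * (1 / 2) ^ i" if i: "i \<notin> support N" for i
    proof -
      have sums: "(\<lambda>e. (1 / 2 :: real) ^ (i + e)) sums (2 * (1 / 2) ^ i)"
        using sums_mult[OF geometric_sums[of "1 / 2 :: real"], of "(1 / 2) ^ i"]
        by (simp add: power_add mult.commute)
      have le: "measure guesses (B i e) \<le> (1 / 2) ^ (i + e)" for e
        using prob_correct_guess[OF i] by (simp add: B_def)
      have summable: "summable (\<lambda>e. measure guesses (B i e))"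
        by (rule summable_comparison_test[OF _ sums_summable[OF sums]]) (use le in auto)
      have "measure guesses (\<Inter>i. \<Union>e. B i e) \<le> measure guesses (\<Union>e. B i e)"
        by (intro guesses.finite_measure_mono) auto
      also have "\<dots> \<le> (\<Sum>e. measure guesses (B i e))"
        by (intro guesses.finite_measure_subadditive_countably summable) auto
      also have "\<dots> \<le> (\<Sum>e. (1 / 2) ^ (i + e))"
        by (intro suminf_le le summable sums_summable[OF sums])
      also have "\<dots> = 2 * (1 / 2) ^ i" using sums by (simp add: sums_iff)
      finally show ?thesis .
    qed
    obtain m where m: "\<forall>i\<in>support N. i < m"
      using finite_support finite_nat_set_iff_bounded by blast
    have "measure guesses (\<Inter>i. \<Union>e. B i e) \<le> 0"
    proof (rule LIMSEQ_le_const)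
      show "(\<lambda>i. 2 * (1 / 2 :: real) ^ i) \<longlonglongrightarrow> 0"
        by real_asymp
      show "\<exists>n. \<forall>i\<ge>n. measure guesses (\<Inter>i. \<Union>e. B i e) \<le> 2 * (1 / 2) ^ i"
        using m bound by (meson linorder_not_le)
    qed
    then have "emeasure guesses (\<Inter>i. \<Union>e. B i e) = 0"
      by (simp add: guesses.emeasure_eq_measure measure_le_0_iff)
    moreover have "(\<Inter>i. \<Union>e. B i e) \<in> sets guesses" by measurable
    ultimately show ?thesis
      by (intro AE_I[where N = "\<Inter>i. \<Union>e. B i e"]) (auto simp: B_def)
  qed
  then show ?thesis by (subst AE_all_countable) blast
qed

section \<open>Killing homogeneous sets\<close>

lemma take_prefix_of: "n \<le> m \<Longrightarrow> take n (prefix_of h m) = prefix_of h n"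
  by (simp add: prefix_of_def take_map)

lemma prefix_of_split: "n \<le> m \<Longrightarrow> prefix_of h m = prefix_of h n @ map h [n..<m]"
  using upt_add_eq_append[of 0 n "m - n"] by (simp add: prefix_of_def flip: map_append)

lemma prefix_of_eq_iff: "prefix_of h n = prefix_of h' n \<longleftrightarrow> (\<forall>k<n. h k = h' k)"
  by (auto simp: prefix_of_def)

text \<open>
  Membership in the denotation of \<open>N\<close> is forced if it follows from the constraints \<open>c\<close> and a finite
  part of \<open>w\<close>, as long as the name is good. In this form forcing is an open condition on \<open>w\<close>, hence
  measurable, and monotone in \<open>c\<close>.
\<close>

definition forces :: "nm \<Rightarrow> constr list \<Rightarrow> (nat \<Rightarrow> nat) \<Rightarrow> nat \<Rightarrow> bool" where
  "forces N c w x \<longleftrightarrow> (\<exists>n. \<forall>h' w'. prefix_of h' (length c) = c \<longrightarrow> prefix_of w' n = prefix_of w n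
    \<longrightarrow> good (h', w') N \<longrightarrow> x \<in> denot (h', w') N)"

definition killed :: "nm \<Rightarrow> constr list \<Rightarrow> (nat \<Rightarrow> nat) set" where
  "killed N c = {w. \<exists>i j. opposite c i j \<and> forces N c w i \<and> forces N c w j}"

lemma forces_append:
  assumes "forces N c w x"
  shows "forces N (c @ d) w x"
proof -
  have "prefix_of h' (length c) = c" if "prefix_of h' (length (c @ d)) = c @ d" for h'
    using take_prefix_of[of "length c" "length (c @ d)" h'] unfolding that by simp
  then show ?thesis using assms unfolding forces_def by meson
qed

lemma colourings_append: "colourings (c @ d) = colourings c \<inter> colourings d"
  by (simp only: colourings_def set_append ball_Un Collect_conj_eq)

lemma killed_append: "killed N c \<subseteq> killed N (c @ d)"
proof -
  have "opposite (c @ d) i j" if "opposite c i j" for i j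
    using that unfolding opposite_def colourings_append by blast
  then show ?thesis unfolding killed_def using forces_append by blast
qed

lemma forcesD: "forces N (prefix_of h n) w x \<Longrightarrow> good (h, w) N \<Longrightarrow> x \<in> denot (h, w) N"
  by (auto simp: forces_def)

lemma eventually_forces:
  assumes "good (h, w) N" "x \<in> denot (h, w) N"
  shows "\<forall>\<^sub>F n in sequentially. forces N (prefix_of h n) w x"
  using denot_finite_use[OF assms(1), of x]
proof eventually_elim
  case (elim n)
  have "agree n (h, w) (h', w')"
    if "prefix_of h' (length (prefix_of h n)) = prefix_of h n" "prefix_of w' n = prefix_of w n" for h' w'
    using that by (simp add: prefix_of_eq_iff agree_def)
  then show ?case using elim assms(2) unfolding forces_def by blast
qed

lemma pred_prefix_of [measurable]: "Measurable.pred guesses (\<lambda>w. P (prefix_of w n))"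
proof -
  have "prefix_of w n = l \<longleftrightarrow> length l = n \<and> (\<forall>k<n. w k = l ! k)" for w :: "nat \<Rightarrow> nat" and l
    by (auto simp: list_eq_iff_nth_eq prefix_of_def)
  moreover have "Measurable.pred guesses (\<lambda>w. length l = n \<and> (\<forall>k<n. w k = l ! k))" for l
    by measurable
  ultimately have "Measurable.pred guesses (\<lambda>w. prefix_of w n = l)" for l
    by simp
  then have "Measurable.pred guesses (\<lambda>w. P l \<and> prefix_of w n = l)" for l
    by (cases "P l") simp_all
  then have "Measurable.pred guesses (\<lambda>w. \<exists>l. P l \<and> prefix_of w n = l)"
    by (rule pred_intros_countable)
  moreover have "(\<exists>l. P l \<and> prefix_of w n = l) \<longleftrightarrow> P (prefix_of w n)" for w by blast
  ultimately show ?thesis by (simp only:)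
qed

lemma pred_forces [measurable]: "Measurable.pred guesses (\<lambda>w. forces N c w x)"
  unfolding forces_def by measurable

lemma sets_killed [measurable]: "killed N c \<in> sets guesses"
proof -
  have "Measurable.pred guesses (\<lambda>w. \<exists>i j. opposite c i j \<and> forces N c w i \<and> forces N c w j)"
    by measurable
  then show ?thesis by (simp add: pred_def killed_def)
qed

text \<open>
  The sum is a convenient strict upper bound of all numbers mentioned in the constraints that is
  additive under concatenation and grows with every constraint.
\<close>

definition bound :: "constr list \<Rightarrow> nat" where
  "bound c = (\<Sum>(i, j, b)\<leftarrow>c. i + j + 1)"

definition above :: "nat \<Rightarrow> constr list \<Rightarrow> bool" where
  "above r d \<longleftrightarrow> (\<forall>(i, j, b)\<in>set d. r \<le> i \<and> r \<le> j)"

lemma less_bound: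
  assumes "(i, j, b) \<in> set c"
  shows "i < bound c" "j < bound c"
proof -
  have "i + j + 1 \<le> bound c"
    unfolding bound_def by (rule member_le_sum_list) (use assms in force)+
  then show "i < bound c" "j < bound c" by auto
qed

lemma bound_append [simp]: "bound (c @ d) = bound c + bound d"
  by (simp add: bound_def)

lemma length_le_bound: "length c \<le> bound c"
  by (induction c) (auto simp: bound_def)

lemma above_append [simp]: "above r (c @ d) \<longleftrightarrow> above r c \<and> above r d"
  by (simp only: above_def set_append ball_Un)

text \<open>
  These are the solutions of the associated homogeneous system: adding one of them to a colouring
  of \<open>c\<close> modulo 2 gives another colouring of \<open>c\<close>.
\<close>

definition flips :: "constr list \<Rightarrow> (nat \<Rightarrow> bool) \<Rightarrow> bool" where
  "flips c z \<longleftrightarrow> (\<forall>(i, j, b)\<in>set c. z i = z j)"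

lemma card_bipartition:
  assumes fin: "finite G" and inv: "\<And>x. x \<in> G \<Longrightarrow> f x \<in> G \<and> f (f x) = x \<and> (P (f x) \<longleftrightarrow> \<not> P x)"
  shows "real (card {x \<in> G. P x}) = real (card G) / 2"
proof -
  have "bij_betw f {x \<in> G. P x} {x \<in> G. \<not> P x}"
    by (rule bij_betw_byWitness[where f' = f]) (use inv in auto)
  then have "card {x \<in> G. P x} = card {x \<in> G. \<not> P x}" by (rule bij_betw_same_card)
  moreover have "card G = card {x \<in> G. P x} + card {x \<in> G. \<not> P x}"
    using fin by (subst card_Un_disjoint[symmetric]) (auto intro: arg_cong[where f = card])
  ultimately show ?thesis by simp
qed

text \<open>
  The heart of the construction. For every \<open>w \<in> U\<close> the forced elements \<open>i\<close> and \<open>j\<close> are independent in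
  \<open>c\<close>: adding the solution \<open>z\<close> is an involution of the colourings of \<open>c\<close> that switches between
  equal and opposite colours of \<open>i\<close> and \<open>j\<close>. Hence half of the colourings make them opposite, and by
  averaging over \<open>U\<close> some colouring does so for half of \<open>U\<close>. The constraints \<open>d\<close> prescribe this
  colouring up to complement on all numbers between \<open>r\<close> and the bound \<open>R\<close>.
\<close>

lemma ex_merge:
  assumes cons: "colourings c \<noteq> {}" and U [measurable]: "U \<in> sets guesses"
    and split: "\<And>w. w \<in> U \<Longrightarrow> \<exists>i j. r \<le> i \<and> i < m \<and> r \<le> j \<and> j < m \<and> (\<exists>z. flips c z \<and> z i \<noteq> z j)
      \<and> forces N c w i \<and> forces N c w j"
  shows "\<exists>d. above r d \<and> colourings (c @ d) \<noteq> {}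
    \<and> measure guesses U / 2 \<le> measure guesses (U \<inter> killed N (c @ d))"
proof -
  define R where "R = max m (bound c)"
  \<comment> \<open>Cutting off at \<open>R\<close> makes the set of colourings finite and loses nothing, as \<open>c\<close> does not
    mention numbers from \<open>R\<close> on.\<close>
  define G where "G = {\<xi> \<in> colourings c. \<forall>x\<ge>R. \<not> \<xi> x}"
  define d where "d \<xi> = [(i, j, \<xi> i \<noteq> \<xi> j). i \<leftarrow> [r..<R], j \<leftarrow> [r..<R]]" for \<xi> :: "nat \<Rightarrow> bool"
  define V where "V \<xi> = U \<inter> {w. \<exists>i j. r \<le> i \<and> i < R \<and> r \<le> j \<and> j < R \<and> \<xi> i \<noteq> \<xi> j
      \<and> forces N c w i \<and> forces N c w j}" for \<xi> :: "nat \<Rightarrow> bool"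
  have d: "above r (d \<xi>)" "\<xi> \<in> colourings (d \<xi>)" for \<xi> :: "nat \<Rightarrow> bool"
    by (auto simp: above_def d_def colourings_def)
  have V_killed: "V \<xi> \<subseteq> U \<inter> killed N (c @ d \<xi>)" for \<xi>
  proof -
    have "opposite (c @ d \<xi>) i j" if "r \<le> i" "i < R" "r \<le> j" "j < R" "\<xi> i \<noteq> \<xi> j" for i j
    proof -
      have "(i, j, True) \<in> set (d \<xi>)" 
        using that by (auto simp: d_def intro!: bexI[of _ i] image_eqI[of _ _ j])
      then show ?thesis by (auto simp: opposite_def colourings_append dest: colouringsD)
    qed
    then show ?thesis unfolding V_def killed_def using forces_append by blast
  qed
  have sets_V [measurable]: "V \<xi> \<in> sets guesses" for \<xi>
  proof -
    have "Measurable.pred guesses (\<lambda>w. \<exists>i j. r \<le> i \<and> i < R \<and> r \<le> j \<and> j < R \<and> \<xi> i \<noteq> \<xi> j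
      \<and> forces N c w i \<and> forces N c w j)" by measurable
    then show ?thesis unfolding V_def by (intro sets.Int U) (simp add: pred_def)
  qed
  have below: "i < R" "j < R" if "(i, j, b) \<in> set c" for i j b
    using less_bound[OF that] by (auto simp: R_def)
  have "G \<subseteq> (\<lambda>S x. x \<in> S) ` Pow {..<R}"
  proof
    fix \<xi> assume "\<xi> \<in> G"
    then have "\<xi> = (\<lambda>x. x \<in> {x. \<xi> x})" "{x. \<xi> x} \<subseteq> {..<R}"
      by (auto simp: G_def) (meson not_le)
    then show "\<xi> \<in> (\<lambda>S x. x \<in> S) ` Pow {..<R}" by blast
  qed
  then have fin: "finite G" by (rule finite_subset) simp
  obtain \<xi> where "\<xi> \<in> colourings c" using cons by blast
  then have "(\<lambda>x. \<xi> x \<and> x < R) \<in> G"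
    using below unfolding G_def colourings_def by (fastforce)
  then have "G \<noteq> {}" by blast
  have half: "real (card G) / 2 \<le> (\<Sum>\<xi>\<in>G. indicator (V \<xi>) w)" if w: "w \<in> U" for w
  proof -
    obtain i j z where ij: "r \<le> i" "i < m" "r \<le> j" "j < m" "flips c z" "z i \<noteq> z j"
      "forces N c w i" "forces N c w j" using split[OF w] by blast
    define f where "f \<xi> = (\<lambda>x. \<xi> x \<noteq> (z x \<and> x < R))" for \<xi> :: "nat \<Rightarrow> bool"
    have "f \<xi> \<in> G \<and> f (f \<xi>) = \<xi> \<and> (f \<xi> i \<noteq> f \<xi> j \<longleftrightarrow> \<not> \<xi> i \<noteq> \<xi> j)" if "\<xi> \<in> G" for \<xi>
    proof (intro conjI)
      have "f \<xi> \<in> colourings c"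
      proof (rule colouringsI)
        fix a a' b assume a: "(a, a', b) \<in> set c"
        then have "z a = z a'" using \<open>flips c z\<close> by (auto simp: flips_def)
        moreover have "(\<xi> a \<noteq> \<xi> a') = b" using that colouringsD[OF _ a, of \<xi>] by (simp add: G_def)
        ultimately show "(f \<xi> a \<noteq> f \<xi> a') = b" using below[OF a] by (auto simp: f_def)
      qed
      then show "f \<xi> \<in> G" using that by (auto simp: G_def f_def)
    qed (use ij in \<open>auto simp: f_def R_def\<close>)
    then have "real (card G) / 2 = real (card {\<xi> \<in> G. \<xi> i \<noteq> \<xi> j})"
      using card_bipartition[OF fin, of f "\<lambda>\<xi>. \<xi> i \<noteq> \<xi> j"] by simp
    also have "\<dots> \<le> real (card {\<xi> \<in> G. w \<in> V \<xi>})"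
    proof -
      have "{\<xi> \<in> G. \<xi> i \<noteq> \<xi> j} \<subseteq> {\<xi> \<in> G. w \<in> V \<xi>}"
        using ij \<open>w \<in> U\<close> unfolding V_def R_def by fastforce
      then show ?thesis using fin by (simp add: card_mono)
    qed
    also have "\<dots> = (\<Sum>\<xi>\<in>G. indicator (V \<xi>) w)"
      using fin by (simp add: indicator_def sum.If_cases Int_def)
    finally show ?thesis .
  qed
  have "measure guesses U / 2 * card G = (\<integral>w. real (card G) / 2 * indicator U w \<partial>guesses)"
    by simp
  also have "\<dots> \<le> (\<integral>w. (\<Sum>\<xi>\<in>G. indicator (V \<xi>) w) \<partial>guesses)"
  proof (rule integral_mono)
    show "real (card G) / 2 * indicator U w \<le> (\<Sum>\<xi>\<in>G. indicator (V \<xi>) w)" for w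
      using half[of w] by (cases "w \<in> U") (auto intro: sum_nonneg)
  qed (auto intro!: Bochner_Integration.integrable_sum simp: guesses.emeasure_eq_measure)
  also have "\<dots> = (\<Sum>\<xi>\<in>G. measure guesses (V \<xi>))"
    by (subst Bochner_Integration.integral_sum) (auto simp: guesses.emeasure_eq_measure)
  finally have sum: "measure guesses U / 2 * card G \<le> (\<Sum>\<xi>\<in>G. measure guesses (V \<xi>))" .
  have "\<exists>\<xi>\<in>G. measure guesses U / 2 \<le> measure guesses (V \<xi>)"
  proof (rule ccontr)
    assume "\<not> ?thesis"
    then have "(\<Sum>\<xi>\<in>G. measure guesses (V \<xi>)) < (\<Sum>\<xi>\<in>G. measure guesses U / 2)"
      using fin \<open>G \<noteq> {}\<close> by (intro sum_strict_mono) auto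
    then show False using sum by (simp add: mult.commute)
  qed
  then obtain \<xi> where \<xi>: "\<xi> \<in> G" "measure guesses U / 2 \<le> measure guesses (V \<xi>)" by blast
  have "measure guesses (V \<xi>) \<le> measure guesses (U \<inter> killed N (c @ d \<xi>))"
    by (intro guesses.finite_measure_mono V_killed) measurable
  moreover have "\<xi> \<in> colourings (c @ d \<xi>)"
    using \<xi>(1) d by (simp add: colourings_append G_def)
  ultimately show ?thesis using d \<xi>(2) by (intro exI[of _ "d \<xi>"]) auto
qed

text \<open>
  Take \<open>d\<close> with a value within \<open>\<epsilon>\<close> of the supremum; all extensions of \<open>d\<close> compete in that supremum.
  Asking for a nonempty \<open>d\<close> makes the sequence of constraints infinite in the limit.
\<close>

lemma ex_nearly_maximal_extension:
  fixes \<epsilon> :: real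
  assumes "colourings c \<noteq> {}" "0 < \<epsilon>"
  shows "\<exists>d. d \<noteq> [] \<and> above (bound c) d \<and> colourings (c @ d) \<noteq> {} \<and>
    (\<forall>d'. above (bound c) d' \<longrightarrow> colourings (c @ d @ d') \<noteq> {} \<longrightarrow>
      measure guesses (killed N (c @ d @ d')) \<le> measure guesses (killed N (c @ d)) + \<epsilon>)"
proof -
  define Q where "Q d \<longleftrightarrow> d \<noteq> [] \<and> above (bound c) d \<and> colourings (c @ d) \<noteq> {}" for d
  define \<mu> where "\<mu> d = measure guesses (killed N (c @ d))" for d
  \<comment> \<open>A constraint that every colouring satisfies.\<close>
  have "Q [(bound c, bound c, False)]"
    using assms(1) by (auto simp: Q_def above_def colourings_def)
  then have ne: "\<mu> ` Collect Q \<noteq> {}" by blast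
  have bdd: "bdd_above (\<mu> ` Collect Q)"
    by (rule bdd_aboveI[of _ 1]) (auto simp: \<mu>_def)
  obtain d where d: "Q d" "Sup (\<mu> ` Collect Q) - \<epsilon> < \<mu> d"
    using less_cSupD[OF ne, of "Sup (\<mu> ` Collect Q) - \<epsilon>"] assms(2) by auto
  have "\<mu> (d @ d') \<le> \<mu> d + \<epsilon>" if "above (bound c) d'" "colourings (c @ d @ d') \<noteq> {}" for d'
  proof -
    have "Q (d @ d')" using d(1) that by (simp add: Q_def)
    then have "\<mu> (d @ d') \<le> Sup (\<mu> ` Collect Q)" by (intro cSup_upper bdd) simp
    then show ?thesis using d(2) by simp
  qed
  then show ?thesis using d(1) unfolding Q_def \<mu>_def by blast
qed

text \<open>
  Stage \<open>n + 1\<close> treats the \<open>n\<close>-th pair of a name \<open>N\<close> and a precision \<open>2\<^sup>-\<^sup>k\<close>. Its new constraints are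
  on numbers from \<open>bound (stage n)\<close> on, so that the blocks of the earlier numbers stay as they are.
\<close>

definition next_batch :: "constr list \<Rightarrow> nm \<times> nat \<Rightarrow> constr list" where
  "next_batch c Nk = (case Nk of (N, k) \<Rightarrow> SOME d. d \<noteq> [] \<and> above (bound c) d \<and> colourings (c @ d) \<noteq> {} \<and>
    (\<forall>d'. above (bound c) d' \<longrightarrow> colourings (c @ d @ d') \<noteq> {} \<longrightarrow>
      measure guesses (killed N (c @ d @ d')) \<le> measure guesses (killed N (c @ d)) + (1 / 2) ^ k))"

primrec stage :: "nat \<Rightarrow> constr list" where
  "stage 0 = []"
| "stage (Suc n) = stage n @ next_batch (stage n) (from_nat n)"

definition generic :: "nat \<Rightarrow> constr" where
  "generic l = stage (Suc l) ! l"

lemma next_batch: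
  assumes "colourings c \<noteq> {}"
  shows "next_batch c (N, k) \<noteq> []" "above (bound c) (next_batch c (N, k))"
    "colourings (c @ next_batch c (N, k)) \<noteq> {}"
    "above (bound c) d' \<Longrightarrow> colourings (c @ next_batch c (N, k) @ d') \<noteq> {} \<Longrightarrow>
      measure guesses (killed N (c @ next_batch c (N, k) @ d'))
        \<le> measure guesses (killed N (c @ next_batch c (N, k))) + (1 / 2) ^ k"
  using someI_ex[OF ex_nearly_maximal_extension[OF assms, of "(1 / 2) ^ k" N]]
  unfolding next_batch_def by auto

lemma stage_consistent: "colourings (stage n) \<noteq> {}"
proof (induction n)
  case (Suc n)
  then show ?case using next_batch(3) by (cases "from_nat n :: nm \<times> nat") simp
qed (simp add: colourings_def)

lemma stage_extends: "m \<le> n \<Longrightarrow> \<exists>d. stage n = stage m @ d \<and> above (bound (stage m)) d"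
proof (induction n rule: dec_induct)
  case (step n)
  then obtain d where d: "stage n = stage m @ d" "above (bound (stage m)) d" by blast
  have "above (bound (stage n)) (next_batch (stage n) (from_nat n))"
    using next_batch(2)[OF stage_consistent] by (cases "from_nat n :: nm \<times> nat") simp
  then have "above (bound (stage m)) (next_batch (stage n) (from_nat n))"
    unfolding d(1) by (auto simp: above_def)
  then show ?case using d by simp
qed (simp add: above_def)

lemma length_stage: "n \<le> length (stage n)"
proof (induction n)
  case (Suc n)
  have "next_batch (stage n) (from_nat n) \<noteq> []"
    using next_batch(1)[OF stage_consistent] by (cases "from_nat n :: nm \<times> nat") simp
  then have "Suc 0 \<le> length (next_batch (stage n) (from_nat n))" by (simp add: Suc_le_eq)
  then show ?case using Suc by simp
qed simp

lemma generic_stage: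
  assumes "l < length (stage n)"
  shows "generic l = stage n ! l"
proof -
  have "\<exists>d. stage (max n (Suc l)) = stage n @ d" "\<exists>d. stage (max n (Suc l)) = stage (Suc l) @ d"
    using stage_extends by (meson max.cobounded1 max.cobounded2)+
  then show ?thesis
    using assms length_stage[of "Suc l"] unfolding generic_def
    by (metis Suc_le_lessD nth_append)
qed

lemma prefix_of_generic: "prefix_of generic (length (stage n)) = stage n"
  by (rule nth_equalityI) (simp_all add: generic_stage prefix_of_def)

lemma generic_consistent: "colourings (prefix_of generic n) \<noteq> {}"
proof -
  have "colourings (stage n) \<subseteq> colourings (prefix_of generic n)"
    using prefix_of_split[OF length_stage[of n], of generic]
    unfolding prefix_of_generic by (metis colourings_append inf_le1)
  then show ?thesis using stage_consistent by blast
qed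

text \<open>
  No constraint of the limit sequence relates a number below \<open>bound (stage n)\<close> to one above it. So
  numbers are related only within the finite intervals between consecutive bounds.
\<close>

lemma generic_separated:
  assumes "generic l = (i, j, b)"
  shows "i < bound (stage n) \<longleftrightarrow> j < bound (stage n)"
    and "length (stage n) \<le> l \<Longrightarrow> bound (stage n) \<le> i \<and> bound (stage n) \<le> j"
proof -
  show *: "bound (stage n) \<le> i \<and> bound (stage n) \<le> j" if "length (stage n) \<le> l"
  proof -
    have "n \<le> Suc l" using length_stage[of n] that by simp
    then obtain d where d: "stage (Suc l) = stage n @ d" "above (bound (stage n)) d"
      using stage_extends by blast
    have "l < length (stage (Suc l))" using length_stage[of "Suc l"] by simp
    then have "l - length (stage n) < length d" using that unfolding d(1) by simp
    then have "d ! (l - length (stage n)) \<in> set d" by (rule nth_mem)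
    then have "(i, j, b) \<in> set d"
      using that assms unfolding generic_def d(1) by (simp add: nth_append)
    then show ?thesis using d(2) by (auto simp: above_def)
  qed
  show "i < bound (stage n) \<longleftrightarrow> j < bound (stage n)"
  proof (cases "length (stage n) \<le> l")
    case False
    then have "(i, j, b) \<in> set (stage n)"
      using assms generic_stage by (metis not_le nth_mem)
    then show ?thesis using less_bound by blast
  qed (use * in auto)
qed

text \<open>
  For the stage that treats \<open>(N, k)\<close>, the set \<open>U k m\<close> contains the \<open>w\<close> that are not killed at that
  stage although the first \<open>m\<close> constraints force two elements that the whole sequence leaves
  unrelated. Merging would kill half of it, and the near-maximality of the stage bounds its
  probability. If \<open>N\<close> is good, infinite and never killed, then \<open>w\<close> lies in \<open>U k m\<close> for every \<open>k\<close> and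
  all large \<open>m\<close>: two elements on different sides of some bound are separated by flipping all
  numbers below that bound.
\<close>

theorem AE_killed:
  "AE w in guesses. \<forall>N. good (generic, w) N \<longrightarrow> infinite (denot (generic, w) N)
    \<longrightarrow> (\<exists>n. w \<in> killed N (prefix_of generic n))"
proof -
  have "AE w in guesses. good (generic, w) N \<longrightarrow> infinite (denot (generic, w) N)
    \<longrightarrow> (\<exists>n. w \<in> killed N (prefix_of generic n))" for N
  proof -
    define n where "n k = to_nat (N, k :: nat)" for k
    define r where "r k = bound (stage (n k))" for k
    define U where "U k m = {w. w \<notin> killed N (stage (Suc (n k))) \<and>
      (\<exists>i j. r k \<le> i \<and> i < m \<and> r k \<le> j \<and> j < m \<and> (\<exists>z. (\<forall>l. flips (prefix_of generic l) z) \<and> z i \<noteq> z j)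
        \<and> forces N (prefix_of generic m) w i \<and> forces N (prefix_of generic m) w j)}" for k m
    have sets_U [measurable]: "U k m \<in> sets guesses" for k m
    proof -
      have [measurable]: "Measurable.pred guesses (\<lambda>w. w \<in> killed N c)" for c
        by (rule pred_sets2) measurable
      have "Measurable.pred guesses (\<lambda>w. w \<notin> killed N (stage (Suc (n k))) \<and>
      (\<exists>i j. r k \<le> i \<and> i < m \<and> r k \<le> j \<and> j < m \<and> (\<exists>z. (\<forall>l. flips (prefix_of generic l) z) \<and> z i \<noteq> z j)
        \<and> forces N (prefix_of generic m) w i \<and> forces N (prefix_of generic m) w j))"
        by measurable
      then show ?thesis by (simp add: pred_def U_def)
    qed
    have forces_le: "forces N (prefix_of generic m') w i"
      if "forces N (prefix_of generic m) w i" "m \<le> m'" for m m' w i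
      using forces_append[OF that(1)] unfolding prefix_of_split[OF that(2)] .
    have U_le: "measure guesses (U k m) \<le> 2 * (1 / 2) ^ k" for k m
    proof -
      define c0 where "c0 = stage (Suc (n k))"
      define m' where "m' = max m (length c0)"
      define d0 where "d0 = map generic [length c0..<m']"
      define c where "c = prefix_of generic m'"
      have c: "c = c0 @ d0"
        unfolding c_def d0_def m'_def
        using prefix_of_split[of "length c0" "max m (length c0)" generic] prefix_of_generic
        by (simp add: c0_def del: stage.simps)
      have "above (r k) d0"
      proof -
        have "length (stage (n k)) \<le> length c0" by (simp add: c0_def)
        then show ?thesis
          using generic_separated(2)[of _ _ _ _ "n k"] unfolding d0_def above_def r_def
          by auto
      qed
      have "colourings c \<noteq> {}" unfolding c_def by (rule generic_consistent)
      moreover have "\<exists>i j. r k \<le> i \<and> i < m \<and> r k \<le> j \<and> j < m \<and> (\<exists>z. flips c z \<and> z i \<noteq> z j)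
          \<and> forces N c w i \<and> forces N c w j" if "w \<in> U k m" for w
      proof -
        have "m \<le> m'" by (simp add: m'_def)
        then show ?thesis using that forces_le unfolding U_def c_def by blast
      qed
      ultimately obtain d where d: "above (r k) d" "colourings (c @ d) \<noteq> {}"
        "measure guesses (U k m) / 2 \<le> measure guesses (U k m \<inter> killed N (c @ d))"
        using ex_merge[OF _ sets_U] by blast
      have "measure guesses (killed N c0) + measure guesses (U k m) / 2
          \<le> measure guesses (killed N c0) + measure guesses (U k m \<inter> killed N (c @ d))"
        using d(3) by simp
      also have "\<dots> = measure guesses (killed N c0 \<union> (U k m \<inter> killed N (c @ d)))"
        by (rule guesses.finite_measure_Union[symmetric]) (auto simp: U_def c0_def)
      also have "\<dots> \<le> measure guesses (killed N (c @ d))"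
        using killed_append[of N c0 "d0 @ d"] by (intro guesses.finite_measure_mono) (auto simp: c)
      also have "\<dots> \<le> measure guesses (killed N c0) + (1 / 2) ^ k"
        using next_batch(4)[OF stage_consistent, of "n k" "d0 @ d" N k] d(1,2) \<open>above (r k) d0\<close>
        by (simp add: c c0_def n_def r_def)
      finally show ?thesis by simp
    qed
    have "incseq (U k)" for k
      unfolding incseq_def U_def using forces_le by (auto; meson order_less_le_trans)
    then have lim: "(\<lambda>m. measure guesses (U k m)) \<longlonglongrightarrow> measure guesses (\<Union>m. U k m)" for k
      by (intro guesses.finite_Lim_measure_incseq) auto
    have UN_le: "measure guesses (\<Union>m. U k m) \<le> 2 * (1 / 2) ^ k" for k
      by (rule LIMSEQ_le_const2[OF lim]) (use U_le in blast)
    have "measure guesses (\<Inter>k. \<Union>m. U k m) \<le> 0"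
    proof (rule LIMSEQ_le_const)
      show "(\<lambda>k. 2 * (1 / 2 :: real) ^ k) \<longlonglongrightarrow> 0"
        by real_asymp
      have "measure guesses (\<Inter>k. \<Union>m. U k m) \<le> measure guesses (\<Union>m. U k m)" for k
        by (intro guesses.finite_measure_mono) auto
      then show "\<exists>n. \<forall>k\<ge>n. measure guesses (\<Inter>k. \<Union>m. U k m) \<le> 2 * (1 / 2) ^ k"
        using UN_le order_trans by blast
    qed
    then have null: "emeasure guesses (\<Inter>k. \<Union>m. U k m) = 0"
      by (simp add: guesses.emeasure_eq_measure measure_le_0_iff)
    have "w \<in> (\<Union>m. U k m)"
      if w: "good (generic, w) N" "infinite (denot (generic, w) N)" "\<forall>n. w \<notin> killed N (prefix_of generic n)"
      for w k
    proof -
      obtain i where i: "r k \<le> i" "i \<in> denot (generic, w) N"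
        using w(2) infinite_nat_iff_unbounded_le by blast
      define s where "s = bound (stage (Suc i))"
      have "i < s" using length_stage[of "Suc i"] length_le_bound[of "stage (Suc i)"] by (simp add: s_def)
      obtain j where j: "s \<le> j" "j \<in> denot (generic, w) N"
        using w(2) infinite_nat_iff_unbounded_le by blast
      have "flips (prefix_of generic l) (\<lambda>x. x < s)" for l
      proof -
        have "(p < s) = (q < s)" if pq: "(p, q, b) \<in> set (prefix_of generic l)" for p q b
        proof -
          obtain l' where "generic l' = (p, q, b)" using pq by auto
          then show ?thesis unfolding s_def by (rule generic_separated(1))
        qed
        then show ?thesis unfolding flips_def by blast
      qed
      moreover have "(i < s) \<noteq> (j < s)" using \<open>i < s\<close> j by simp
      moreover have "\<forall>\<^sub>F m in sequentially. forces N (prefix_of generic m) w i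
          \<and> forces N (prefix_of generic m) w j \<and> i < m \<and> j < m"
        using eventually_forces[OF w(1) i(2)] eventually_forces[OF w(1) j(2)]
        by (intro eventually_conj eventually_gt_at_top)
      then obtain m where "forces N (prefix_of generic m) w i" "forces N (prefix_of generic m) w j"
        "i < m" "j < m"
        by (auto simp: eventually_sequentially)
      moreover have "w \<notin> killed N (stage (Suc (n k)))"
        using w(3) prefix_of_generic by metis
      moreover have "r k \<le> j" using i j \<open>i < s\<close> by simp
      ultimately show ?thesis using i unfolding U_def by blast
    qed
    moreover have "(\<Inter>k. \<Union>m. U k m) \<in> sets guesses" by measurable
    ultimately show ?thesis
      using null by (intro AE_I[where N = "\<Inter>k. \<Union>m. U k m"]) auto
  qed
  then show ?thesis by (subst AE_all_countable) blast
qed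

section \<open>The separation\<close>

theorem corollary6p12:
  shows "\<not> (RCA0 \<union> {DNR} \<turnstile> RWKL)"
proof
  assume proof_of_RWKL: "RCA0 \<union> {DNR} \<turnstile> RWKL"
  have ae: "AE w in guesses. (\<forall>N. \<exists>i. \<forall>e. \<not> phi (denot (generic, w) N) e e (w (prod_encode (i, e))))
    \<and> (\<forall>N. good (generic, w) N \<longrightarrow> infinite (denot (generic, w) N)
      \<longrightarrow> (\<exists>n. w \<in> killed N (prefix_of generic n)))"
    using AE_diagonal_nonrecursive AE_killed by (rule AE_conjI)
  obtain w where
    dnr: "\<And>N. \<exists>i. \<forall>e. \<not> phi (denot (generic, w) N) e e (w (prod_encode (i, e)))" and
    kill: "\<And>N. good (generic, w) N \<Longrightarrow> infinite (denot (generic, w) N)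
      \<Longrightarrow> \<exists>n. w \<in> killed N (prefix_of generic n)"
    using eventually_happens[OF ae] by (auto simp: trivial_limit_def)
  let ?M = "model (generic, w)"
  have "sat ?M (nenv []) (senv []) DNR"
  proof (rule sat_DNR)
    fix X assume "X \<in> ?M"
    then obtain N where N: "X = denot (generic, w) N" by (auto simp: model_def)
    obtain i where "\<forall>e. \<not> phi X e e (w (prod_encode (i, e)))" using dnr[of N] N by blast
    moreover have "range (\<lambda>e. pr e (w (prod_encode (i, e)))) \<in> ?M"
      unfolding model_def by (intro CollectI exI[of _ "Fun i"]) simp
    ultimately show "\<exists>f. range (\<lambda>e. pr e (f e)) \<in> ?M \<and> (\<forall>e. \<not> phi X e e (f e))"
      by (intro exI[of _ "\<lambda>e. w (prod_encode (i, e))"]) simp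
  qed
  moreover have "range (senv []) \<subseteq> ?M"
    using empty_in_model by (auto simp: senv_def)
  ultimately have "sat ?M (nenv []) (senv []) RWKL"
    using soundness[OF proof_of_RWKL] sat_RCA0 by blast
  moreover have "\<not> sat ?M (nenv []) (senv []) RWKL"
  proof (rule not_sat_RWKL)
    show "scode ` ptree generic \<in> ?M"
      unfolding model_def by (intro CollectI exI[of _ Tree]) simp
    show "colourings (prefix_of generic n) \<noteq> {}" for n by (rule generic_consistent)
    fix H assume "H \<in> ?M" "infinite H"
    then obtain N where N: "good (generic, w) N" "H = denot (generic, w) N" by (auto simp: model_def)
    then obtain n i j where "opposite (prefix_of generic n) i j"
      "forces N (prefix_of generic n) w i" "forces N (prefix_of generic n) w j"
      using kill[OF N(1)] \<open>infinite H\<close> unfolding killed_def by blast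
    then show "\<exists>i\<in>H. \<exists>j\<in>H. \<exists>n. opposite (prefix_of generic n) i j"
      using forcesD N by blast
  qed
  ultimately show False by blast
qed

end
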